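(* Let $n\ge1$, let $3\le q\le n$ be an integer, let $\Lambda\subseteq\mathbb{Z}/q\mathbb{Z}$ be non-empty, and define $\eta=|\mathrm{supp}\,\mathcal{D}_{q,\Lambda}|\cdot2^{-n}$. Let $f\colon\{0,1\}^m\to\{0,1\}^n$ be a $d$-local function. Then $$\|f(\mathcal{U}^m)-\mathcal{D}_{q,\Lambda}\|\ge 1-\frac{6q}{\eta}\exp\left\{-\frac{n}{q^2\cdot\mathrm{tow}_2(18d)}\right\}-\begin{cases}|\Lambda|/q & q\text{ odd},\\ 2\max\{|\Lambda_{\mathsf{even}}|,|\Lambda_{\mathsf{odd}}|\}/q & q\text{ even}.\end{cases}$$
   Context: $\mathcal{U}^m$ is uniform on $\{0,1\}^m$. $\mathcal{D}_{q,\Lambda}$ is the uniform distribution over $x\in\{0,1\}^n$ with $|x|\bmod q\in\Lambda$, where $|x|$ is the Hamming weight. For even $q$, $\Lambda_{\mathsf{even}}$ and $\Lambda_{\mathsf{odd}}$ are the sets of elements of $\Lambda$ that are even, respectively odd (well defined since $q$ is even). A function is $d$-local if each output bit depends on at most $d$ input bits. $\mathrm{tow}_2(0)=1$, $\mathrm{tow}_2(h)=2^{\mathrm{tow}_2(h-1)}$. $\|\cdot\|$ is total variation distance. *)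

theory Defs
  imports Complex_Main
begin

definition cube :: "nat \<Rightarrow> bool list set" where
  "cube n = {xs. length xs = n}"

definition hweight :: "bool list \<Rightarrow> nat" where
  "hweight xs = length (filter id xs)"

definition push_unif :: "(bool list \<Rightarrow> bool list) \<Rightarrow> nat \<Rightarrow> bool list \<Rightarrow> real" where
  "push_unif f m y = real (card {x \<in> cube m. f x = y}) / 2 ^ m"

text \<open>Support of D_{q,Lambda}; Lambda is given by residues in {0..<q}.\<close>
definition supp_D :: "nat \<Rightarrow> nat \<Rightarrow> nat set \<Rightarrow> bool list set" where
  "supp_D n q \<Lambda> = {x \<in> cube n. hweight x mod q \<in> \<Lambda>}"

definition D_dist :: "nat \<Rightarrow> nat \<Rightarrow> nat set \<Rightarrow> bool list \<Rightarrow> real" where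
  "D_dist n q \<Lambda> y = (if y \<in> supp_D n q \<Lambda> then 1 / real (card (supp_D n q \<Lambda>)) else 0)"

definition tv_dist :: "nat \<Rightarrow> (bool list \<Rightarrow> real) \<Rightarrow> (bool list \<Rightarrow> real) \<Rightarrow> real" where
  "tv_dist n P Q = (1/2) * (\<Sum>y\<in>cube n. \<bar>P y - Q y\<bar>)"

definition local_fun :: "nat \<Rightarrow> nat \<Rightarrow> nat \<Rightarrow> (bool list \<Rightarrow> bool list) \<Rightarrow> bool" where
  "local_fun m n d f \<longleftrightarrow>
     (\<forall>x\<in>cube m. f x \<in> cube n) \<and>
     (\<forall>i<n. \<exists>S. S \<subseteq> {..<m} \<and> card S \<le> d \<and>
        (\<forall>x\<in>cube m. \<forall>y\<in>cube m. (\<forall>j\<in>S. x ! j = y ! j) \<longrightarrow> f x ! i = f y ! i))"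

fun tow2 :: "nat \<Rightarrow> nat" where
  "tow2 0 = 1"
| "tow2 (Suc h) = 2 ^ tow2 h"

end

theory Submission
  imports Defs "HOL-Analysis.Complex_Transcendental" "HOL-Library.Disjoint_Sets"
begin

text \<open>
  Fix a small set \<open>S\<close> of input bits. After that, many output bits \<open>i\<close> (the centres) have
  bounded neighbourhoods \<open>N i\<close> (the outputs sharing a free input with \<open>i\<close>), and the
  neighbourhoods of distinct centres depend on disjoint sets \<open>J i\<close> of free inputs.
  For a given value of the bits in \<open>S\<close> there are two cases.

  If at least half of the neighbourhoods are not exactly uniform, each is at distance at least
  \<open>2 ^ - D\<close> from uniform by granularity. The Bhattacharyya affinity is multiplicative
  over independent blocks, so the overlap with the uniform distribution is exponentially small in
  the number of centres; this beats the union bound over the \<open>2 ^ card S\<close> values.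

  If at least half are exactly uniform, condition on all inputs which no centre reads. The blocks
  are then still independent, and the weight of a block cannot always be determined modulo the
  order of a root of unity \<open>z\<close> with \<open>z\<^sup>2 \<noteq> 1\<close>: otherwise the block's character
  would be uncorrelated with the centre bit, whereas in a uniform block the correlation is
  \<open>(1 - z) (1 + z) ^ (t - 1) / 2 ^ t\<close>. Hence all these characters of the total
  weight are small, and only the trivial and the parity character contribute to the probability
  of hitting the support.

  The set \<open>S\<close> comes from a greedy elimination: a maximal disjoint subfamily of a family of
  sets is either large, or its union is small and removing it shrinks every set. Applied to the
  input sets of the outputs this takes at most \<open>d\<close> rounds, each costing two exponentials.
\<close>

section \<open>Sums over powersets and laws of Boolean maps\<close>

lemma sum_Pow_Un:
  assumes "finite A" "finite B" "A \<inter> B = {}"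
  shows "(\<Sum>X\<in>Pow (A \<union> B). g X) = (\<Sum>X\<in>Pow A. \<Sum>Y\<in>Pow B. g (X \<union> Y))"
proof -
  have "(\<Sum>X\<in>Pow A. \<Sum>Y\<in>Pow B. g (X \<union> Y)) = (\<Sum>(X, Y)\<in>Pow A \<times> Pow B. g (X \<union> Y))"
    by (simp add: sum.cartesian_product)
  also have "\<dots> = (\<Sum>X\<in>Pow (A \<union> B). g X)"
    using assms(3)
    by (intro sum.reindex_bij_witness[where i = "\<lambda>Z. (Z \<inter> A, Z \<inter> B)" and j = "\<lambda>(X, Y). X \<union> Y"]) auto
  finally show ?thesis by simp
qed

lemma sum_Pow_subset:
  assumes "finite A" "B \<subseteq> A"
  shows "(\<Sum>X\<in>Pow A. g X) = (\<Sum>X\<in>Pow B. \<Sum>Y\<in>Pow (A - B). g (X \<union> Y))"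
  using sum_Pow_Un[of B "A - B" g] assms
  by (metis Diff_disjoint Diff_partition finite_Diff rev_finite_subset)

lemma sum_Pow_insert:
  assumes "finite A" "a \<notin> A"
  shows "(\<Sum>X\<in>Pow (insert a A). g X) = (\<Sum>X\<in>Pow A. g X + g (insert a X))"
proof -
  have "{} \<noteq> {a}" by simp
  then show ?thesis using sum_Pow_Un[of A "{a}" g] assms by (simp add: Pow_insert add.commute)
qed

lemma sum_Pow_Int:
  fixes g :: "'a set \<Rightarrow> 'b::comm_semiring_1"
  assumes "finite A" "B \<subseteq> A"
  shows "(\<Sum>X\<in>Pow A. g (X \<inter> B)) = 2 ^ card (A - B) * (\<Sum>X\<in>Pow B. g X)"
proof -
  have "(X \<union> Y) \<inter> B = X" if "X \<subseteq> B" "Y \<subseteq> A - B" for X Y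
    using that by blast
  then show ?thesis
    using assms by (simp add: sum_Pow_subset[OF assms] card_Pow sum_distrib_left)
qed

text \<open>Independence in unnormalised form: the bits in disjoint sets \<open>J i\<close> are
  chosen separately, so the sum of the product is the product of the block sums. The induction peels
  off one block.\<close>

lemma sum_Pow_prod:
  fixes g :: "'i \<Rightarrow> 'a set \<Rightarrow> 'b::comm_semiring_1"
  assumes "finite M" "\<And>i. i \<in> M \<Longrightarrow> finite (J i)" "disjoint_family_on J M"
  shows "(\<Sum>X\<in>Pow (\<Union>i\<in>M. J i). \<Prod>i\<in>M. g i (X \<inter> J i)) = (\<Prod>i\<in>M. \<Sum>X\<in>Pow (J i). g i X)"
  using assms
proof (induction M rule: finite_induct)
  case empty
  then show ?case by simp
next
  case (insert a M)
  let ?K = "\<Union>i\<in>M. J i"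
  have disj: "J a \<inter> ?K = {}" and disj': "disjoint_family_on J M"
    using insert.prems(2) insert.hyps(2) by (fastforce simp: disjoint_family_on_def)+
  have fin: "finite (J a)" "finite ?K" using insert by auto
  have split: "(\<Prod>i\<in>insert a M. g i ((X \<union> Y) \<inter> J i)) = g a X * (\<Prod>i\<in>M. g i (Y \<inter> J i))"
    if "X \<in> Pow (J a)" "Y \<in> Pow ?K" for X Y
  proof -
    have "(X \<union> Y) \<inter> J a = X" using that disj by auto
    moreover have "(X \<union> Y) \<inter> J i = Y \<inter> J i" if "i \<in> M" for i
      using that \<open>X \<in> Pow (J a)\<close> disj by auto
    ultimately show ?thesis using insert.hyps by simp
  qed
  have "(\<Sum>X\<in>Pow (\<Union>i\<in>insert a M. J i). \<Prod>i\<in>insert a M. g i (X \<inter> J i))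
      = (\<Sum>X\<in>Pow (J a). \<Sum>Y\<in>Pow ?K. g a X * (\<Prod>i\<in>M. g i (Y \<inter> J i)))"
    using sum_Pow_Un[OF fin disj, of "\<lambda>X. \<Prod>i\<in>insert a M. g i (X \<inter> J i)"] split
    by simp
  also have "\<dots> = (\<Sum>X\<in>Pow (J a). g a X) * (\<Sum>Y\<in>Pow ?K. \<Prod>i\<in>M. g i (Y \<inter> J i))"
    by (simp add: sum_product)
  also have "(\<Sum>Y\<in>Pow ?K. \<Prod>i\<in>M. g i (Y \<inter> J i)) = (\<Prod>i\<in>M. \<Sum>X\<in>Pow (J i). g i X)"
    by (rule insert.IH) (use insert.prems disj' in auto)
  finally show ?case using insert.hyps by simp
qed

lemma sum_Pow_power_card:
  fixes z :: "'a::comm_semiring_1"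
  assumes "finite A"
  shows "(\<Sum>X\<in>Pow A. z ^ card X) = (1 + z) ^ card A"
  using assms
proof (induction A rule: finite_induct)
  case (insert a A)
  have "(\<Sum>X\<in>Pow (insert a A). z ^ card X) = (\<Sum>X\<in>Pow A. z ^ card X + z * z ^ card X)"
    unfolding sum_Pow_insert[OF insert.hyps]
  proof (rule sum.cong)
    fix X assume "X \<in> Pow A"
    then have "finite X" "a \<notin> X" using insert.hyps finite_subset by auto
    then show "z ^ card X + z ^ card (insert a X) = z ^ card X + z * z ^ card X" by simp
  qed simp
  also have "\<dots> = (1 + z) * (\<Sum>X\<in>Pow A. z ^ card X)"
    by (simp add: sum.distrib sum_distrib_left distrib_right)
  finally show ?case using insert by simp
qed simp

text \<open>\<open>law U F V\<close> is the distribution of the set of output bits \<open>v \<in> V\<close> that are true, on a uniform input \<open>X \<subseteq> U\<close>.\<close>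

definition out :: "('b \<Rightarrow> 'a set \<Rightarrow> bool) \<Rightarrow> 'b set \<Rightarrow> 'a set \<Rightarrow> 'b set" where
  "out F V X = {v \<in> V. F v X}"

definition law :: "'a set \<Rightarrow> ('b \<Rightarrow> 'a set \<Rightarrow> bool) \<Rightarrow> 'b set \<Rightarrow> 'b set \<Rightarrow> real" where
  "law U F V Y = (\<Sum>X\<in>Pow U. of_bool (out F V X = Y)) / 2 ^ card U"

lemma law_nonneg: "law U F V Y \<ge> 0"
  by (simp add: law_def sum_nonneg)

text \<open>Change of variables between an expectation under the output law and an average over
  inputs. Values in a real vector space serve both probabilities and complex characters.\<close>

lemma sum_law:
  fixes g :: "'b set \<Rightarrow> 'c::real_vector"
  assumes "finite U" "finite V"
  shows "(\<Sum>Y\<in>Pow V. law U F V Y *\<^sub>R g Y) = (\<Sum>X\<in>Pow U. g (out F V X)) /\<^sub>R 2 ^ card U"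
proof -
  have out: "out F V X \<in> Pow V" for X by (auto simp: out_def)
  have "(\<Sum>Y\<in>Pow V. law U F V Y *\<^sub>R g Y)
      = (\<Sum>Y\<in>Pow V. \<Sum>X\<in>Pow U. (if Y = out F V X then g Y else 0) /\<^sub>R 2 ^ card U)"
    unfolding law_def sum_divide_distrib scaleR_left.sum
    by (intro sum.cong refl) (auto simp: divide_inverse)
  also have "\<dots> = (\<Sum>X\<in>Pow U. \<Sum>Y\<in>Pow V. (if Y = out F V X then g Y else 0)) /\<^sub>R 2 ^ card U"
    by (subst sum.swap) (simp add: scaleR_right.sum)
  also have "\<dots> = (\<Sum>X\<in>Pow U. g (out F V X)) /\<^sub>R 2 ^ card U"
    using assms out by simp
  finally show ?thesis .
qed

lemma sum_law_eq_1:
  assumes "finite U" "finite V"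
  shows "(\<Sum>Y\<in>Pow V. law U F V Y) = 1"
  using sum_law[OF assms, of F "\<lambda>_. 1::real"] assms by (simp add: card_Pow)

lemma law_marginal:
  assumes "finite U" "finite V" "N \<subseteq> V" "Z \<subseteq> N"
  shows "(\<Sum>W\<in>Pow (V - N). law U F V (Z \<union> W)) = law U F N Z"
proof -
  have *: "(\<Sum>W\<in>Pow (V - N). of_bool (out F V X = Z \<union> W)) = (of_bool (out F N X = Z) :: real)" for X
  proof -
    \<comment> \<open>As \<open>Z\<close> lies in \<open>N\<close> and \<open>W\<close> outside it,
      the output set determines both, so only one \<open>W\<close> can contribute.\<close>
    have "(out F V X = Z \<union> W) = (out F N X = Z \<and> W = out F (V - N) X)" if "W \<in> Pow (V - N)" for W
      using that assms(3,4) unfolding out_def by auto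
    then have "(\<Sum>W\<in>Pow (V - N). of_bool (out F V X = Z \<union> W))
      = (\<Sum>W\<in>Pow (V - N). if W = out F (V - N) X then of_bool (out F N X = Z) else (0::real))"
      by (intro sum.cong) auto
    also have "\<dots> = of_bool (out F N X = Z)"
      using assms by (auto simp: out_def)
    finally show ?thesis .
  qed
  have "(\<Sum>W\<in>Pow (V - N). law U F V (Z \<union> W))
    = (\<Sum>X\<in>Pow U. \<Sum>W\<in>Pow (V - N). of_bool (out F V X = Z \<union> W)) / 2 ^ card U"
    unfolding law_def sum_divide_distrib[symmetric] by (subst sum.swap) simp
  then show ?thesis unfolding * law_def .
qed

section \<open>Blocks far from uniform\<close>

text \<open>Cauchy-Schwarz for the vectors of square roots.\<close>

lemma sum_sqrt_mult_le:
  fixes a b :: "'a \<Rightarrow> real"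
  assumes "\<And>x. x \<in> A \<Longrightarrow> a x \<ge> 0" "\<And>x. x \<in> A \<Longrightarrow> b x \<ge> 0"
  shows "(\<Sum>x\<in>A. sqrt (a x * b x)) \<le> sqrt ((\<Sum>x\<in>A. a x) * (\<Sum>x\<in>A. b x))"
proof -
  have "(\<Sum>x\<in>A. sqrt (a x * b x)) = (\<Sum>x\<in>A. \<bar>sqrt (a x)\<bar> * \<bar>sqrt (b x)\<bar>)"
    using assms by (intro sum.cong refl) (simp add: real_sqrt_mult)
  also have "\<dots> \<le> L2_set (\<lambda>x. sqrt (a x)) A * L2_set (\<lambda>x. sqrt (b x)) A"
    by (rule L2_set_mult_ineq)
  also have "\<dots> = sqrt ((\<Sum>x\<in>A. a x) * (\<Sum>x\<in>A. b x))"
    using assms by (simp add: L2_set_def real_sqrt_mult cong: sum.cong)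
  finally show ?thesis .
qed

text \<open>Forgetting outputs can only increase the Bhattacharyya affinity: Cauchy-Schwarz is
  applied on each fibre over \<open>Z\<close>. This allows restricting attention to the outputs in
  chosen blocks.\<close>

lemma affinity_marginal:
  assumes "finite U" "finite V" "N \<subseteq> V"
  shows "(\<Sum>Y\<in>Pow V. sqrt (law U F V Y * (1 / 2 ^ card V)))
       \<le> (\<Sum>Z\<in>Pow N. sqrt (law U F N Z * (1 / 2 ^ card N)))"
proof -
  have card: "card V = card N + card (V - N)"
    using assms by (metis card_Un_disjoint Diff_disjoint Diff_partition finite_Diff finite_subset)
  have "(\<Sum>Y\<in>Pow V. sqrt (law U F V Y * (1 / 2 ^ card V)))
     = (\<Sum>Z\<in>Pow N. \<Sum>W\<in>Pow (V - N). sqrt (law U F V (Z \<union> W) * (1 / 2 ^ card V)))"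
    by (rule sum_Pow_subset) (use assms in auto)
  also have "\<dots> \<le> (\<Sum>Z\<in>Pow N. sqrt ((\<Sum>W\<in>Pow (V - N). law U F V (Z \<union> W)) * (\<Sum>W\<in>Pow (V - N). 1 / 2 ^ card V)))"
    by (intro sum_mono sum_sqrt_mult_le) (auto simp: law_nonneg)
  also have "\<dots> = (\<Sum>Z\<in>Pow N. sqrt (law U F N Z * (1 / 2 ^ card N)))"
    using assms by (intro sum.cong refl) (simp add: law_marginal card_Pow card power_add)
  finally show ?thesis .
qed

lemma law_blocks:
  fixes F :: "'b \<Rightarrow> 'a set \<Rightarrow> bool"
  assumes "finite U" "finite M" "\<And>i. i \<in> M \<Longrightarrow> J i \<subseteq> U" "disjoint_family_on J M"
    and dep: "\<And>i v X. i \<in> M \<Longrightarrow> v \<in> N i \<Longrightarrow> F v X = F v (X \<inter> J i)"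
    and Z: "Z \<subseteq> (\<Union>i\<in>M. N i)"
  shows "law U F (\<Union>i\<in>M. N i) Z = (\<Prod>i\<in>M. law (J i) F (N i) (Z \<inter> N i))"
proof -
  let ?K = "\<Union>i\<in>M. J i"
  let ?g = "\<lambda>i X. of_bool (out F (N i) X = Z \<inter> N i) :: real"
  have K: "?K \<subseteq> U" using assms(3) by auto
  have finJ: "finite (J i)" if "i \<in> M" for i
    using assms(3)[OF that] assms(1) by (rule finite_subset)
  \<comment> \<open>The extra intersection with \<open>?K\<close> displays the integrand as a
    function of \<open>X \<inter> ?K\<close>, so that the inputs outside all blocks sum out as a
    power of 2.\<close>
  have ind: "of_bool (out F (\<Union>i\<in>M. N i) X = Z) = (\<Prod>i\<in>M. ?g i (X \<inter> ?K \<inter> J i))" for X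
  proof -
    have KJ: "X \<inter> ?K \<inter> J i = X \<inter> J i" if "i \<in> M" for i using that by blast
    have outJ: "out F (N i) (X \<inter> J i) = out F (N i) X" if "i \<in> M" for i
      unfolding out_def using dep[OF that] by blast
    have "(\<Prod>i\<in>M. ?g i (X \<inter> ?K \<inter> J i)) = (\<Prod>i\<in>M. of_bool (out F (N i) X = Z \<inter> N i))"
      by (intro prod.cong refl) (simp only: KJ outJ)
    also have "\<dots> = of_bool (\<forall>i\<in>M. out F (N i) X = Z \<inter> N i)"
      using \<open>finite M\<close> by (induction M rule: finite_induct) auto
    also have "(\<forall>i\<in>M. out F (N i) X = Z \<inter> N i) = (out F (\<Union>i\<in>M. N i) X = Z)"
      using Z unfolding out_def by blast
    finally show ?thesis ..
  qed
  have "law U F (\<Union>i\<in>M. N i) Z = (\<Sum>X\<in>Pow U. \<Prod>i\<in>M. ?g i (X \<inter> ?K \<inter> J i)) / 2 ^ card U"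
    unfolding law_def ind ..
  also have "\<dots> = 2 ^ card (U - ?K) * (\<Sum>X\<in>Pow ?K. \<Prod>i\<in>M. ?g i (X \<inter> J i)) / 2 ^ card U"
    by (simp only: sum_Pow_Int[OF assms(1) K, of "\<lambda>X. \<Prod>i\<in>M. ?g i (X \<inter> J i)"])
  also have "\<dots> = (\<Prod>i\<in>M. \<Sum>X\<in>Pow (J i). ?g i X) / 2 ^ card ?K"
  proof -
    have "card U = card (U - ?K) + card ?K"
      using card_mono[OF assms(1) K] card_Diff_subset[OF finite_subset[OF K assms(1)] K] by simp
    then show ?thesis
      by (subst sum_Pow_prod[OF assms(2) finJ assms(4)]) (simp_all add: power_add)
  qed
  also have "card ?K = (\<Sum>i\<in>M. card (J i))"
    using assms(2,4) finJ by (intro card_UN_disjoint') auto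
  also have "(\<Prod>i\<in>M. \<Sum>X\<in>Pow (J i). ?g i X) / 2 ^ (\<Sum>i\<in>M. card (J i)) = (\<Prod>i\<in>M. law (J i) F (N i) (Z \<inter> N i))"
    by (simp add: law_def prod_dividef power_sum)
  finally show ?thesis .
qed

definition uniform_block :: "'a set \<Rightarrow> ('b \<Rightarrow> 'a set \<Rightarrow> bool) \<Rightarrow> 'b set \<Rightarrow> bool" where
  "uniform_block J F N \<longleftrightarrow> (\<forall>Z\<in>Pow N. law J F N Z = 1 / 2 ^ card N)"

text \<open>Under a uniform input on \<open>J\<close> every probability is an integer over
  \<open>2 ^ card J\<close>, which divides the common denominator \<open>2 ^ D\<close>. Hence two
  different such values differ by at least \<open>1 / 2 ^ D\<close>.\<close>

lemma law_granular:
  assumes "finite J" "card J \<le> D"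
  obtains k :: nat where "law J F N Z * 2 ^ D = k"
proof
  have "law J F N Z = card {X \<in> Pow J. out F N X = Z} / 2 ^ card J"
    using assms by (simp add: law_def Int_def)
  moreover have "(2::real) ^ D = 2 ^ card J * 2 ^ (D - card J)"
    using assms(2) by (simp flip: power_add)
  ultimately show "law J F N Z * 2 ^ D = real (card {X \<in> Pow J. out F N X = Z} * 2 ^ (D - card J))"
    by simp
qed

text \<open>By granularity some atom deviates from uniform by at least \<open>1 / 2 ^ D\<close>. It
  alone contributes \<open>1 / (4 * 4 ^ D)\<close> to the squared Hellinger sum, which equals 2
  minus twice the affinity.\<close>

lemma affinity_nonuniform_block:
  assumes "finite J" "finite N" "card J \<le> D" "card N \<le> D" "\<not> uniform_block J F N"
  shows "(\<Sum>Z\<in>Pow N. sqrt (law J F N Z * (1 / 2 ^ card N))) \<le> 1 - 1 / (8 * 4 ^ D)"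
proof -
  let ?p = "law J F N" and ?u = "1 / 2 ^ card N :: real"
  obtain Z where Z: "Z \<in> Pow N" "?p Z \<noteq> ?u" using assms(5) by (auto simp: uniform_block_def)
  have p1: "(\<Sum>Z\<in>Pow N. ?p Z) = 1" by (rule sum_law_eq_1) (use assms in auto)
  have u1: "(\<Sum>Z\<in>Pow N. ?u) = 1" using assms by (simp add: card_Pow)
  obtain k where k: "?p Z * 2 ^ D = real k" using law_granular[OF assms(1,3)] by blast
  have l: "?u * 2 ^ D = real (2 ^ (D - card N))"
    using power_add[of "2::real" "card N" "D - card N"] assms(4) by simp
  have "?p Z * 2 ^ D \<noteq> ?u * 2 ^ D" using Z(2) by (simp only: mult_cancel_right) simp
  then have "real k \<noteq> real (2 ^ (D - card N))" unfolding k l .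
  moreover have "\<bar>real a - real b\<bar> \<ge> 1" if "real a \<noteq> real b" for a b :: nat
    using that by (cases a b rule: linorder_cases) auto
  ultimately have "\<bar>real k - real (2 ^ (D - card N))\<bar> \<ge> 1" by blast
  then have "\<bar>?p Z * 2 ^ D - ?u * 2 ^ D\<bar> \<ge> 1" unfolding k l .
  then have gap: "\<bar>?p Z - ?u\<bar> * 2 ^ D \<ge> 1"
    by (simp only: left_diff_distrib[symmetric] abs_mult) simp
  have ple: "?p Z \<le> 1"
    using member_le_sum[of Z "Pow N" ?p] p1 Z assms by (auto simp: law_nonneg)
  \<comment> \<open>Difference of squares: the cofactor \<open>sqrt (?p Z) + sqrt ?u\<close> is at
    most 2.\<close>
  have s: "(sqrt (?p Z) - sqrt ?u)\<^sup>2 * 4 \<ge> (?p Z - ?u)\<^sup>2"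
  proof -
    have "?p Z - ?u = (sqrt (?p Z) - sqrt ?u) * (sqrt (?p Z) + sqrt ?u)"
      using law_nonneg[of J F N Z] by (simp add: algebra_simps flip: power2_eq_square)
    then have "(?p Z - ?u)\<^sup>2 = (sqrt (?p Z) - sqrt ?u)\<^sup>2 * (sqrt (?p Z) + sqrt ?u)\<^sup>2"
      by (simp add: power_mult_distrib)
    also have "\<dots> \<le> (sqrt (?p Z) - sqrt ?u)\<^sup>2 * 2\<^sup>2"
    proof (intro mult_left_mono power_mono)
      have "sqrt (?p Z) \<le> 1" "sqrt ?u \<le> 1" using ple by auto
      then show "sqrt (?p Z) + sqrt ?u \<le> 2" by linarith
    qed (auto simp: law_nonneg)
    finally show ?thesis by simp
  qed
  have "1 \<le> (\<bar>?p Z - ?u\<bar> * 2 ^ D)\<^sup>2" using gap by (simp add: one_le_power)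
  also have "\<dots> = (?p Z - ?u)\<^sup>2 * 4 ^ D"
  proof -
    have "((2::real) ^ D)\<^sup>2 = (2\<^sup>2) ^ D" by (simp only: power_mult[symmetric] mult.commute)
    then show ?thesis by (simp add: power_mult_distrib)
  qed
  also have "\<dots> \<le> (sqrt (?p Z) - sqrt ?u)\<^sup>2 * 4 * 4 ^ D"
    by (rule mult_right_mono[OF s]) simp
  finally have "1 / (4 * 4 ^ D) \<le> (sqrt (?p Z) - sqrt ?u)\<^sup>2"
    by (simp add: field_simps)
  also have "\<dots> \<le> (\<Sum>Z\<in>Pow N. (sqrt (?p Z) - sqrt ?u)\<^sup>2)"
    by (rule member_le_sum) (use Z assms in auto)
  also have "\<dots> = (\<Sum>Z\<in>Pow N. ?p Z + ?u - 2 * sqrt (?p Z * ?u))"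
    by (intro sum.cong refl) (simp add: power2_diff law_nonneg real_sqrt_mult real_sqrt_divide power_divide)
  also have "\<dots> = 2 - 2 * (\<Sum>Z\<in>Pow N. sqrt (?p Z * ?u))"
    using p1 u1 by (simp add: sum.distrib sum_subtractf sum_distrib_left)
  finally show ?thesis by simp
qed

text \<open>Outputs outside the blocks are dropped; on the rest both laws are products over the
  blocks, so the affinity is a product of block affinities, and \<open>1 - x \<le> exp (- x)\<close>
  turns it into one exponential.\<close>

lemma affinity_blocks:
  fixes F :: "'b \<Rightarrow> 'a set \<Rightarrow> bool"
  assumes "finite U" "finite V" "finite M"
    and J: "\<And>i. i \<in> M \<Longrightarrow> J i \<subseteq> U" "\<And>i. i \<in> M \<Longrightarrow> card (J i) \<le> D" "disjoint_family_on J M"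
    and N: "\<And>i. i \<in> M \<Longrightarrow> N i \<subseteq> V" "\<And>i. i \<in> M \<Longrightarrow> card (N i) \<le> D" "disjoint_family_on N M"
    and dep: "\<And>i v X. i \<in> M \<Longrightarrow> v \<in> N i \<Longrightarrow> F v X = F v (X \<inter> J i)"
    and nonunif: "\<And>i. i \<in> M \<Longrightarrow> \<not> uniform_block (J i) F (N i)"
  shows "(\<Sum>Y\<in>Pow V. sqrt (law U F V Y * (1 / 2 ^ card V))) \<le> exp (- (card M / (8 * 4 ^ D)))"
proof -
  let ?K = "\<Union>i\<in>M. N i"
  have finJ: "finite (J i)" if "i \<in> M" for i
    using J(1)[OF that] assms(1) by (rule finite_subset)
  have finN: "finite (N i)" if "i \<in> M" for i
    using N(1)[OF that] assms(2) by (rule finite_subset)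
  have cardK: "card ?K = (\<Sum>i\<in>M. card (N i))"
    using assms(3) N(3) finN by (intro card_UN_disjoint') auto
  have "(\<Sum>Y\<in>Pow V. sqrt (law U F V Y * (1 / 2 ^ card V)))
     \<le> (\<Sum>Z\<in>Pow ?K. sqrt (law U F ?K Z * (1 / 2 ^ card ?K)))"
    by (rule affinity_marginal) (use assms(1,2) N(1) in blast)+
  also have "\<dots> = (\<Sum>Z\<in>Pow ?K. \<Prod>i\<in>M. sqrt (law (J i) F (N i) (Z \<inter> N i) * (1 / 2 ^ card (N i))))"
  proof (intro sum.cong refl)
    fix Z assume "Z \<in> Pow ?K"
    then have "law U F ?K Z = (\<Prod>i\<in>M. law (J i) F (N i) (Z \<inter> N i))"
      by (intro law_blocks[OF assms(1,3) J(1,3) dep]) auto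
    moreover have "(1 / 2 ^ card ?K :: real) = (\<Prod>i\<in>M. 1 / 2 ^ card (N i))"
      unfolding cardK by (simp add: prod_dividef power_sum)
    moreover have "sqrt (\<Prod>i\<in>M. h i) = (\<Prod>i\<in>M. sqrt (h i))" for h
      using \<open>finite M\<close> by (induction M rule: finite_induct) (auto simp: real_sqrt_mult)
    ultimately show "sqrt (law U F ?K Z * (1 / 2 ^ card ?K))
      = (\<Prod>i\<in>M. sqrt (law (J i) F (N i) (Z \<inter> N i) * (1 / 2 ^ card (N i))))"
      by (simp only: prod.distrib real_sqrt_mult)
  qed
  also have "\<dots> = (\<Prod>i\<in>M. \<Sum>Z\<in>Pow (N i). sqrt (law (J i) F (N i) Z * (1 / 2 ^ card (N i))))"
    by (rule sum_Pow_prod[where J = N and g = "\<lambda>i Z. sqrt (law (J i) F (N i) Z * (1 / 2 ^ card (N i)))"])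
       (use assms(3) N(3) finN in auto)
  also have "\<dots> \<le> (\<Prod>i\<in>M. exp (- (1 / (8 * 4 ^ D))))"
  proof (rule prod_mono, intro conjI)
    fix i assume i: "i \<in> M"
    show "0 \<le> (\<Sum>Z\<in>Pow (N i). sqrt (law (J i) F (N i) Z * (1 / 2 ^ card (N i))))"
      by (intro sum_nonneg) (simp add: law_nonneg)
    have "(\<Sum>Z\<in>Pow (N i). sqrt (law (J i) F (N i) Z * (1 / 2 ^ card (N i)))) \<le> 1 - 1 / (8 * 4 ^ D)"
      by (rule affinity_nonuniform_block) (use i finN finJ J N nonunif in auto)
    also have "\<dots> \<le> exp (- (1 / (8 * 4 ^ D)))"
      using exp_ge_add_one_self[of "- (1 / (8 * 4 ^ D))"] by simp
    finally show "(\<Sum>Z\<in>Pow (N i). sqrt (law (J i) F (N i) Z * (1 / 2 ^ card (N i)))) \<le> exp (- (1 / (8 * 4 ^ D)))" .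
  qed
  also have "\<dots> = exp (- (card M / (8 * 4 ^ D)))"
    by (simp flip: exp_of_nat_mult)
  finally show ?thesis .
qed

section \<open>Uniform blocks and characters\<close>

lemma cmod_root_of_unity:
  fixes z :: complex
  assumes "z ^ q = 1" "q > 0"
  shows "cmod z = 1"
  using assms by (metis norm_one norm_power norm_ge_zero power_eq_imp_eq_base power_one zero_le_one)

text \<open>If \<open>z\<close> were closer to 1, all powers \<open>z ^ j\<close> with
  \<open>j < q\<close> would stay within distance less than 1 of 1 and have positive real part,
  contradicting that they sum to 0.\<close>

lemma root_of_unity_dist_1:
  fixes z :: complex
  assumes "z ^ q = 1" "z \<noteq> 1" "q > 0"
  shows "cmod (1 - z) \<ge> 1 / q"
proof (rule ccontr)
  assume "\<not> ?thesis"
  then have less: "cmod (1 - z) < 1 / q" by simp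
  have z1: "cmod z = 1"
    using cmod_root_of_unity[OF assms(1,3)] .
  have dist: "cmod (1 - z ^ j) \<le> j * cmod (1 - z)" for j
  proof (induction j)
    case (Suc j)
    have "cmod (1 - z ^ Suc j) = cmod ((1 - z) + z * (1 - z ^ j))" by (simp add: algebra_simps)
    also have "\<dots> \<le> cmod (1 - z) + cmod (z * (1 - z ^ j))" by (rule norm_triangle_ineq)
    also have "\<dots> \<le> Suc j * cmod (1 - z)" using Suc z1 by (simp add: norm_mult) (simp add: algebra_simps)
    finally show ?case .
  qed simp
  have "Re (z ^ j) > 0" if "j < q" for j
  proof -
    have "j * cmod (1 - z) \<le> q * cmod (1 - z)" using that by (intro mult_right_mono) auto
    also have "\<dots> < 1" using less assms(3) by (simp add: field_simps)
    finally have "cmod (1 - z ^ j) < 1" using dist[of j] by linarith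
    then show ?thesis using complex_Re_le_cmod[of "1 - z ^ j"] by simp
  qed
  then have "(\<Sum>j<q. Re (z ^ j)) > 0" using assms(3) by (intro sum_pos) auto
  moreover have "(\<Sum>j<q. z ^ j) = 0" using assms by (simp add: geometric_sum)
  ultimately show False by (metis Re_sum less_irrefl zero_complex.simps(1))
qed

text \<open>The parallelogram law converts the distance \<open>1 / q\<close> between the two points
  into a loss in the length of their sum.\<close>

lemma sum_distinct_roots_of_unity:
  fixes a b :: complex
  assumes "a ^ q = 1" "b ^ q = 1" "a \<noteq> b" "q > 0"
  shows "cmod (a + b) \<le> 2 - 1 / (4 * real q ^ 2)"
proof (rule power2_le_imp_le)
  have a1: "cmod a = 1" and b1: "cmod b = 1" using assms cmod_root_of_unity by blast+
  then have "a \<noteq> 0" by auto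
  then have "cmod (a - b) = cmod (a * (1 - b / a))" by (simp add: algebra_simps)
  also have "\<dots> = cmod (1 - b / a)" using a1 by (simp add: norm_mult)
  also have "\<dots> \<ge> 1 / q"
    using assms \<open>a \<noteq> 0\<close> by (intro root_of_unity_dist_1) (auto simp: power_divide)
  finally have "(1 / q)\<^sup>2 \<le> (cmod (a - b))\<^sup>2" by (intro power_mono) auto
  moreover have "(cmod (a + b))\<^sup>2 + (cmod (a - b))\<^sup>2 = 2 * (cmod a)\<^sup>2 + 2 * (cmod b)\<^sup>2"
    unfolding cmod_power2 by (simp add: power2_eq_square algebra_simps)
  moreover have "2 * (cmod a)\<^sup>2 + 2 * (cmod b)\<^sup>2 = 4" using a1 b1 by simp
  ultimately have "(cmod (a + b))\<^sup>2 \<le> 4 - (1 / q)\<^sup>2" by linarith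
  also have "\<dots> = 4 - 4 * (1 / (4 * real q ^ 2))" by (simp add: power_divide)
  also have "\<dots> \<le> 4 - 4 * (1 / (4 * real q ^ 2)) + (1 / (4 * real q ^ 2))\<^sup>2" by simp
  also have "\<dots> = (2 - 1 / (4 * real q ^ 2))\<^sup>2"
    unfolding power2_diff by simp
  finally show "(cmod (a + b))\<^sup>2 \<le> (2 - 1 / (4 * real q ^ 2))\<^sup>2" .
  have "real q ^ 2 \<ge> 1" using assms(4) by (simp add: one_le_power)
  then have "1 / (4 * real q ^ 2) \<le> 1" by (subst divide_le_eq_1_pos) linarith+
  then show "0 \<le> 2 - 1 / (4 * real q ^ 2)" by linarith
qed

section \<open>Characters on one uniform block\<close>

lemma sum_uniform_block:
  fixes g :: "'b set \<Rightarrow> complex"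
  assumes "finite J" "finite N" "uniform_block J F N"
  shows "(\<Sum>X\<in>Pow J. g (out F N X)) = 2 ^ card J / 2 ^ card N * (\<Sum>Z\<in>Pow N. g Z)"
proof -
  have "(\<Sum>X\<in>Pow J. g (out F N X)) /\<^sub>R 2 ^ card J = (\<Sum>Z\<in>Pow N. g Z /\<^sub>R 2 ^ card N)"
    unfolding sum_law[OF assms(1,2), symmetric]
    using assms(3) by (intro sum.cong refl) (simp add: uniform_block_def divide_inverse)
  then show ?thesis
    by (simp add: scaleR_conv_of_real field_simps flip: sum_divide_distrib)
qed

text \<open>\<open>C\<close> stands for the inputs of the centre bit \<open>i\<close>. A character
  that ignored \<open>C\<close> would have zero correlation with the sign \<open>?s\<close> of the
  centre bit, which averages to 0 over \<open>C\<close>; uniformity of the block computes the same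
  correlation as nonzero unless \<open>z\<close> is 1 or -1.\<close>

lemma uniform_block_nonconstant:
  fixes z :: complex
  assumes fin: "finite J" "finite N" and "C \<subseteq> J" "i \<in> N"
    and dep: "\<And>X. F i X = F i (X \<inter> C)"
    and unif: "uniform_block J F N" and z: "z\<^sup>2 \<noteq> 1"
  obtains \<sigma> \<tau> where "\<sigma> \<in> Pow (J - C)" "\<tau> \<in> Pow C"
    "z ^ card (out F N (\<sigma> \<union> \<tau>)) \<noteq> z ^ card (out F N \<sigma>)"
proof (rule ccontr)
  let ?h = "\<lambda>X. z ^ card (out F N X)"
  let ?s = "\<lambda>b. if b then - 1 else 1 :: complex"
  let ?k = "2 ^ card J / 2 ^ card N :: complex"
  assume nothesis: "\<not> thesis"
  note witness = that
  have const: "?h (\<sigma> \<union> \<tau>) = ?h \<sigma>" if "\<sigma> \<in> Pow (J - C)" "\<tau> \<in> Pow C" for \<sigma> \<tau>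
    using nothesis witness that by blast
  have sgn: "?s (F i X) = ?s (i \<in> out F N X)" for X using \<open>i \<in> N\<close> by (simp add: out_def)
  have N: "N = insert i (N - {i})" using \<open>i \<in> N\<close> by blast
  have fin': "finite (N - {i})" "i \<notin> N - {i}" using fin by auto
  have "(\<Sum>X\<in>Pow J. ?s (F i X)) = ?k * (\<Sum>Z\<in>Pow N. ?s (i \<in> Z))"
    unfolding sgn by (rule sum_uniform_block[OF fin unif])
  also have "(\<Sum>Z\<in>Pow N. ?s (i \<in> Z)) = 0"
    by (subst N, subst sum_Pow_insert[OF fin']) (auto intro!: sum.neutral)
  finally have "(\<Sum>X\<in>Pow J. ?s (F i X)) = 0" by simp
  moreover have "(\<Sum>X\<in>Pow J. ?s (F i X)) = (\<Sum>X\<in>Pow J. ?s (F i (X \<inter> C)))"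
    by (subst dep) (rule refl)
  moreover have "\<dots> = 2 ^ card (J - C) * (\<Sum>X\<in>Pow C. ?s (F i X))"
    by (rule sum_Pow_Int[of J C "\<lambda>X. ?s (F i X)"]) (use assms in auto)
  ultimately have bal: "(\<Sum>X\<in>Pow C. ?s (F i X)) = 0" by simp
  have JC: "J - (J - C) = C" using \<open>C \<subseteq> J\<close> by blast
  \<comment> \<open>The correlation is evaluated twice: here by splitting off the bits of
    \<open>C\<close>, which gives 0, and then by uniformity, which gives a multiple of
    \<open>(1 - z) * (1 + z) ^ card (N - {i})\<close>.\<close>
  have "(\<Sum>X\<in>Pow J. ?h X * ?s (F i X))
      = (\<Sum>\<sigma>\<in>Pow (J - C). \<Sum>\<tau>\<in>Pow C. ?h (\<sigma> \<union> \<tau>) * ?s (F i (\<sigma> \<union> \<tau>)))"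
    by (subst sum_Pow_subset[of J "J - C"]) (use fin in \<open>auto simp: JC\<close>)
  also have "\<dots> = (\<Sum>\<sigma>\<in>Pow (J - C). \<Sum>\<tau>\<in>Pow C. ?h \<sigma> * ?s (F i \<tau>))"
  proof (intro sum.cong refl)
    fix \<sigma> \<tau> assume "\<sigma> \<in> Pow (J - C)" "\<tau> \<in> Pow C"
    moreover from this have "(\<sigma> \<union> \<tau>) \<inter> C = \<tau>" by blast
    then have "F i (\<sigma> \<union> \<tau>) = F i \<tau>" using dep[of "\<sigma> \<union> \<tau>"] by simp
    ultimately show "?h (\<sigma> \<union> \<tau>) * ?s (F i (\<sigma> \<union> \<tau>)) = ?h \<sigma> * ?s (F i \<tau>)"
      using const by simp
  qed
  also have "\<dots> = 0" using bal by (simp flip: sum_distrib_left)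
  also have "(\<Sum>X\<in>Pow J. ?h X * ?s (F i X)) = ?k * (\<Sum>Z\<in>Pow N. z ^ card Z * ?s (i \<in> Z))"
    unfolding sgn by (rule sum_uniform_block[OF fin unif, of "\<lambda>Z. z ^ card Z * ?s (i \<in> Z)"])
  also have "(\<Sum>Z\<in>Pow N. z ^ card Z * ?s (i \<in> Z)) = (\<Sum>Z\<in>Pow (N - {i}). (1 - z) * z ^ card Z)"
  proof (subst N, subst sum_Pow_insert[OF fin'], intro sum.cong refl)
    fix Z assume "Z \<in> Pow (N - {i})"
    then have "finite Z" "i \<notin> Z" using fin' finite_subset by auto
    then show "z ^ card Z * ?s (i \<in> Z) + z ^ card (insert i Z) * ?s (i \<in> insert i Z) = (1 - z) * z ^ card Z"
      by (simp add: algebra_simps)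
  qed
  also have "\<dots> = (1 - z) * (1 + z) ^ card (N - {i})"
    using fin' by (simp add: sum_Pow_power_card flip: sum_distrib_left)
  finally have "1 - z = 0 \<or> 1 + z = 0" by auto
  then have "(1 - z) * (1 + z) = 0" by auto
  then show False using z by (simp add: power2_eq_square algebra_simps)
qed

text \<open>For one setting \<open>\<sigma>\<close> of the bits outside \<open>C\<close>, two values
  of the character differ and partly cancel; every other setting is bounded trivially. The absolute
  loss \<open>1 / (4 * real q ^ 2)\<close> becomes a relative one because
  \<open>2 ^ card J \<le> 2 ^ D\<close>.\<close>

lemma uniform_block_bound:
  fixes z :: complex
  assumes fin: "finite J" "finite N" and "card J \<le> D" "C \<subseteq> J" "i \<in> N"
    and dep: "\<And>X. F i X = F i (X \<inter> C)"
    and unif: "uniform_block J F N" and z: "z ^ q = 1" "q > 0" "z\<^sup>2 \<noteq> 1"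
  shows "(\<Sum>\<sigma>\<in>Pow (J - C). cmod (\<Sum>\<tau>\<in>Pow C. z ^ card (out F N (\<sigma> \<union> \<tau>))))
    \<le> 2 ^ card J * (1 - 1 / (4 * real q ^ 2 * 2 ^ D))"
proof -
  let ?h = "\<lambda>X. z ^ card (out F N X)"
  let ?e = "1 / (4 * real q ^ 2)"
  obtain \<sigma> \<tau> where st: "\<sigma> \<in> Pow (J - C)" "\<tau> \<in> Pow C" "?h (\<sigma> \<union> \<tau>) \<noteq> ?h \<sigma>"
    using uniform_block_nonconstant[OF fin assms(4,5) dep unif z(3)] by blast
  then have "\<tau> \<noteq> {}" by auto
  have finC: "finite C" using assms finite_subset by blast
  have h1: "cmod (?h X) = 1" for X
    using cmod_root_of_unity[OF z(1,2)] by (simp add: norm_power)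
  have hq: "?h X ^ q = 1" for X using z(1) by (metis power_mult mult.commute power_one)
  \<comment> \<open>The terms for \<open>{}\<close> and for the fixed \<open>\<tau>\<close> are
    isolated. In \<open>{{}, \<tau>}\<close> the fixed set is meant; the summation variable shadows
    it only in the summand.\<close>
  have "cmod (\<Sum>\<tau>\<in>Pow C. ?h (\<sigma> \<union> \<tau>)) = cmod ((?h (\<sigma> \<union> \<tau>) + ?h \<sigma>) + (\<Sum>\<tau>\<in>Pow C - {{}, \<tau>}. ?h (\<sigma> \<union> \<tau>)))"
    using st \<open>\<tau> \<noteq> {}\<close> finC by (simp add: sum.subset_diff[of "{{}, \<tau>}" "Pow C"] add_ac)
  also have "\<dots> \<le> cmod (?h (\<sigma> \<union> \<tau>) + ?h \<sigma>) + (\<Sum>\<tau>\<in>Pow C - {{}, \<tau>}. cmod (?h (\<sigma> \<union> \<tau>)))"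
    by (rule order_trans[OF norm_triangle_ineq]) (intro add_mono norm_sum order_refl)
  also have "\<dots> \<le> (2 - ?e) + (\<Sum>\<tau>\<in>Pow C - {{}, \<tau>}. 1)"
    unfolding h1 by (intro add_mono sum_distinct_roots_of_unity hq st z order_refl)
  also have "(\<Sum>\<tau>\<in>Pow C - {{}, \<tau>}. 1 :: real) = 2 ^ card C - 2"
  proof -
    have "{{}, \<tau>} \<subseteq> Pow C" "card {{}, \<tau>} = 2" using st \<open>\<tau> \<noteq> {}\<close> by auto
    then have "(\<Sum>\<tau>\<in>Pow C. 1 :: real) = (\<Sum>\<tau>\<in>Pow C - {{}, \<tau>}. 1) + (\<Sum>\<tau>\<in>{{}, \<tau>}. 1)"
      using finC by (intro sum.subset_diff) auto
    then show ?thesis using \<open>card {{}, \<tau>} = 2\<close> finC by (simp add: card_Pow)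
  qed
  finally have main: "cmod (\<Sum>\<tau>\<in>Pow C. ?h (\<sigma> \<union> \<tau>)) \<le> 2 ^ card C - ?e" by simp
  have triv: "cmod (\<Sum>\<tau>\<in>Pow C. ?h (\<rho> \<union> \<tau>)) \<le> 2 ^ card C" for \<rho>
    using norm_sum[of "\<lambda>\<tau>. ?h (\<rho> \<union> \<tau>)" "Pow C"] finC by (simp add: h1 card_Pow)
  have "(\<Sum>\<sigma>\<in>Pow (J - C). cmod (\<Sum>\<tau>\<in>Pow C. ?h (\<sigma> \<union> \<tau>)))
      \<le> (\<Sum>\<rho>\<in>Pow (J - C). 2 ^ card C - (if \<rho> = \<sigma> then ?e else 0))"
    by (intro sum_mono) (use main triv in auto)
  also have "\<dots> = 2 ^ card (J - C) * 2 ^ card C - ?e"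
    using st(1) fin by (simp add: sum_subtractf card_Pow)
  also have "2 ^ card (J - C) * 2 ^ card C = (2 ^ card J :: real)"
    using assms(4) fin by (metis card_Diff_subset card_mono finite_subset le_add_diff_inverse2 power_add)
  also have "2 ^ card J - ?e \<le> 2 ^ card J * (1 - 1 / (4 * real q ^ 2 * 2 ^ D))"
  proof -
    have "(2::real) ^ card J / 2 ^ D \<le> 1" using assms(3) by (simp add: power_increasing)
    then have "?e * (2 ^ card J / 2 ^ D) \<le> ?e * 1" by (intro mult_left_mono) auto
    then show ?thesis by (simp add: right_diff_distrib)
  qed
  finally show ?thesis .
qed

text \<open>\<open>c\<close> collects everything that ignores the bits in all \<open>C i\<close>.
  With the bits outside the \<open>C i\<close> fixed, the factors \<open>h i\<close> use separate
  free bits, so the modulus may be taken after the inner sums over \<open>\<tau>\<close> and the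
  result factorises over blocks.\<close>

lemma decoupling:
  fixes c :: "'a set \<Rightarrow> complex" and h :: "'i \<Rightarrow> 'a set \<Rightarrow> complex"
  assumes "finite M" "finite U" "\<And>i. i \<in> M \<Longrightarrow> J i \<subseteq> U" "\<And>i. i \<in> M \<Longrightarrow> C i \<subseteq> J i"
    and "disjoint_family_on J M" "\<And>X. cmod (c X) \<le> 1"
    and "\<And>X Y. X - (\<Union>i\<in>M. C i) = Y - (\<Union>i\<in>M. C i) \<Longrightarrow> c X = c Y"
  shows "cmod (\<Sum>X\<in>Pow U. c X * (\<Prod>i\<in>M. h i (X \<inter> J i)))
    \<le> 2 ^ card (U - (\<Union>i\<in>M. J i)) * (\<Prod>i\<in>M. \<Sum>\<sigma>\<in>Pow (J i - C i). cmod (\<Sum>\<tau>\<in>Pow (C i). h i (\<sigma> \<union> \<tau>)))"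
  using assms
proof (induction M arbitrary: U c rule: finite_induct)
  case empty
  have "cmod (\<Sum>X\<in>Pow U. c X) \<le> (\<Sum>X\<in>Pow U. cmod (c X))" by (rule norm_sum)
  also have "\<dots> \<le> (\<Sum>X\<in>Pow U. 1)" by (intro sum_mono empty.prems)
  finally show ?case using empty.prems(1) by (simp add: card_Pow)
next
  case (insert a M)
  let ?V = "U - J a"
  let ?P = "\<lambda>X. \<Prod>i\<in>M. h i (X \<inter> J i)"
  let ?S = "\<Prod>i\<in>M. \<Sum>\<sigma>\<in>Pow (J i - C i). cmod (\<Sum>\<tau>\<in>Pow (C i). h i (\<sigma> \<union> \<tau>))"
  have Ja: "J a \<subseteq> U" "C a \<subseteq> J a" "finite (J a)" using insert.prems(1-3) by (auto intro: finite_subset)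
  have disj: "J a \<inter> J i = {}" if "i \<in> M" for i
    using disjoint_family_onD[OF insert.prems(4), of a i] that insert.hyps by auto
  have JC: "J a - (J a - C a) = C a" using Ja by blast
  have term_eq: "c (\<sigma> \<union> \<tau> \<union> X) * (\<Prod>i\<in>insert a M. h i ((\<sigma> \<union> \<tau> \<union> X) \<inter> J i))
      = h a (\<sigma> \<union> \<tau>) * (c (\<sigma> \<union> X) * ?P X)"
    if "\<sigma> \<in> Pow (J a - C a)" "\<tau> \<in> Pow (C a)" "X \<in> Pow ?V" for \<sigma> \<tau> X
  proof -
    have "c (\<sigma> \<union> \<tau> \<union> X) = c (\<sigma> \<union> X)" by (rule insert.prems(6)) (use that in auto)
    moreover have "(\<sigma> \<union> \<tau> \<union> X) \<inter> J a = \<sigma> \<union> \<tau>" using that Ja by auto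
    moreover have "(\<sigma> \<union> \<tau> \<union> X) \<inter> J i = X \<inter> J i" if "i \<in> M" for i
      using disj[OF that] \<open>\<sigma> \<in> _\<close> \<open>\<tau> \<in> _\<close> Ja by auto
    ultimately show ?thesis using insert.hyps by (simp add: mult_ac)
  qed
  \<comment> \<open>For fixed \<open>\<sigma>\<close> the map \<open>c (\<sigma> \<union> X)\<close>
    again ignores the bits of the remaining \<open>C i\<close>; this is why \<open>c\<close> is
    generalised in the induction.\<close>
  have IH: "cmod (\<Sum>X\<in>Pow ?V. c (\<sigma> \<union> X) * ?P X) \<le> 2 ^ card (?V - (\<Union>i\<in>M. J i)) * ?S" for \<sigma>
  proof (rule insert.IH)
    show "c (\<sigma> \<union> X) = c (\<sigma> \<union> Y)" if "X - (\<Union>i\<in>M. C i) = Y - (\<Union>i\<in>M. C i)" for X Y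
      by (rule insert.prems(6)) (use that in blast)
    show "disjoint_family_on J M" using insert.prems(4) by (auto simp: disjoint_family_on_def)
    show "J i \<subseteq> ?V" if "i \<in> M" for i using insert.prems(2)[of i] disj[OF that] that by auto
  qed (use insert.prems(1-3,5) in auto)
  have UV: "?V - (\<Union>i\<in>M. J i) = U - (\<Union>i\<in>insert a M. J i)" by auto
  have "(\<Sum>X\<in>Pow U. c X * (\<Prod>i\<in>insert a M. h i (X \<inter> J i)))
      = (\<Sum>\<sigma>\<in>Pow (J a - C a). \<Sum>\<tau>\<in>Pow (C a). \<Sum>X\<in>Pow ?V.
           c (\<sigma> \<union> \<tau> \<union> X) * (\<Prod>i\<in>insert a M. h i ((\<sigma> \<union> \<tau> \<union> X) \<inter> J i)))"
    unfolding sum_Pow_subset[OF \<open>finite U\<close> Ja(1)]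
    by (subst sum_Pow_subset[OF Ja(3), of "J a - C a"]) (auto simp: JC)
  also have "\<dots> = (\<Sum>\<sigma>\<in>Pow (J a - C a). (\<Sum>\<tau>\<in>Pow (C a). h a (\<sigma> \<union> \<tau>)) * (\<Sum>X\<in>Pow ?V. c (\<sigma> \<union> X) * ?P X))"
    unfolding sum_product by (intro sum.cong refl term_eq)
  finally have "cmod (\<Sum>X\<in>Pow U. c X * (\<Prod>i\<in>insert a M. h i (X \<inter> J i)))
      \<le> (\<Sum>\<sigma>\<in>Pow (J a - C a). cmod (\<Sum>\<tau>\<in>Pow (C a). h a (\<sigma> \<union> \<tau>)) * cmod (\<Sum>X\<in>Pow ?V. c (\<sigma> \<union> X) * ?P X))"
    by (simp only: norm_sum flip: norm_mult)
  also have "\<dots> \<le> (\<Sum>\<sigma>\<in>Pow (J a - C a). cmod (\<Sum>\<tau>\<in>Pow (C a). h a (\<sigma> \<union> \<tau>)) * (2 ^ card (?V - (\<Union>i\<in>M. J i)) * ?S))"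
    by (intro sum_mono mult_left_mono IH) auto
  also have "\<dots> = 2 ^ card (?V - (\<Union>i\<in>M. J i)) * ((\<Sum>\<sigma>\<in>Pow (J a - C a). cmod (\<Sum>\<tau>\<in>Pow (C a). h a (\<sigma> \<union> \<tau>))) * ?S)"
    by (simp add: sum_distrib_right sum_distrib_left mult_ac)
  finally show ?case unfolding UV using insert.hyps by simp
qed

text \<open>\<open>M\<close> holds the centres, \<open>N i\<close> the outputs of the block of
  \<open>i\<close>, and \<open>J i\<close> contains all inputs that block reads. By
  \<open>outer\<close>, outputs outside \<open>N i\<close> avoid only \<open>I i\<close>; they may
  still read the rest of \<open>J i\<close>, so the blocks are independent of one another but not of
  the remaining outputs.\<close>

locale nonconnected_blocks =
  fixes U :: "'a set" and V :: "'b set" and I :: "'b \<Rightarrow> 'a set" and F :: "'b \<Rightarrow> 'a set \<Rightarrow> bool"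
    and M :: "'b set" and N :: "'b \<Rightarrow> 'b set" and J :: "'b \<Rightarrow> 'a set" and D :: nat
  assumes fin: "finite U" "finite V"
    and local: "v \<in> V \<Longrightarrow> X \<inter> I v = Y \<inter> I v \<Longrightarrow> F v X = F v Y"
    and J: "i \<in> M \<Longrightarrow> J i \<subseteq> U" "i \<in> M \<Longrightarrow> card (J i) \<le> D" "disjoint_family_on J M"
    and N: "i \<in> M \<Longrightarrow> N i \<subseteq> V" "i \<in> M \<Longrightarrow> card (N i) \<le> D" "disjoint_family_on N M"
    and centre: "i \<in> M \<Longrightarrow> i \<in> N i"
    and inner: "i \<in> M \<Longrightarrow> v \<in> N i \<Longrightarrow> I v \<subseteq> J i"
    and outer: "i \<in> M \<Longrightarrow> v \<in> V - N i \<Longrightarrow> I v \<inter> I i = {}"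
begin

lemma finJ: "i \<in> M \<Longrightarrow> finite (J i)"
  using J(1) fin finite_subset by metis

lemma finN: "i \<in> M \<Longrightarrow> finite (N i)"
  using N(1) fin finite_subset by metis

lemma finM: "finite M"
  using N(1) centre fin by (metis finite_subset subsetD subsetI)

lemma dep_block: "i \<in> M \<Longrightarrow> v \<in> N i \<Longrightarrow> F v X = F v (X \<inter> J i)"
  using inner[of i v] N(1)[of i] by (intro local) auto

text \<open>Splitting the weight additively makes a character of it a product of the shape that
  \<open>decoupling\<close> handles.\<close>

lemma card_out_split:
  assumes "M' \<subseteq> M"
  shows "card (out F V X) = card (out F (V - (\<Union>i\<in>M'. N i)) X) + (\<Sum>i\<in>M'. card (out F (N i) (X \<inter> J i)))"
proof -
  have fM': "finite M'" using assms finM finite_subset by blast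
  have "out F V X = out F (V - (\<Union>i\<in>M'. N i)) X \<union> (\<Union>i\<in>M'. out F (N i) X)"
    using N(1) assms unfolding out_def by blast
  moreover have "out F (V - (\<Union>i\<in>M'. N i)) X \<inter> (\<Union>i\<in>M'. out F (N i) X) = {}"
    by (auto simp: out_def)
  moreover have "finite (out F (V - (\<Union>i\<in>M'. N i)) X)" using fin by (simp add: out_def)
  moreover have finout: "finite (out F (N i) X)" if "i \<in> M'" for i
    using finN assms that by (auto simp: out_def)
  moreover have "card (\<Union>i\<in>M'. out F (N i) X) = (\<Sum>i\<in>M'. card (out F (N i) X))"
  proof (rule card_UN_disjoint')
    show "disjoint_family_on (\<lambda>i. out F (N i) X) M'"
      using N(3) assms unfolding disjoint_family_on_def out_def by blast
  qed (use finout fM' in auto)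
  moreover have "out F (N i) X = out F (N i) (X \<inter> J i)" if "i \<in> M'" for i
    unfolding out_def using dep_block that assms by blast
  ultimately show ?thesis
    using fM' by (simp add: card_Un_disjoint cong: sum.cong)
qed

text \<open>\<open>decoupling\<close> is used with \<open>C i = I i\<close> and with
  \<open>c\<close> the character of the outputs outside all chosen blocks, which reads no centre
  input by \<open>outer\<close>. Each uniform block then contributes one saving factor.\<close>

lemma character_bound:
  fixes z :: complex
  assumes "M' \<subseteq> M" and unif: "\<And>i. i \<in> M' \<Longrightarrow> uniform_block (J i) F (N i)"
    and z: "z ^ q = 1" "q > 0" "z\<^sup>2 \<noteq> 1"
  shows "cmod (\<Sum>X\<in>Pow U. z ^ card (out F V X)) \<le> 2 ^ card U * exp (- (card M' / (4 * real q ^ 2 * 2 ^ D)))"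
proof -
  let ?K = "\<Union>i\<in>M'. J i"
  let ?c = "\<lambda>X. z ^ card (out F (V - (\<Union>i\<in>M'. N i)) X)"
  let ?h = "\<lambda>i X. z ^ card (out F (N i) X)"
  have fM': "finite M'" using assms finM finite_subset by blast
  have M': "i \<in> M" if "i \<in> M'" for i using that assms by blast
  have dJ: "disjoint_family_on J M'" using J(3) assms by (auto simp: disjoint_family_on_def)
  have K: "?K \<subseteq> U" "finite ?K" using J(1) M' fM' finJ by auto
  have IJ: "I i \<subseteq> J i" if "i \<in> M'" for i using M'[OF that] inner centre by blast
  have "cmod (\<Sum>X\<in>Pow U. z ^ card (out F V X)) = cmod (\<Sum>X\<in>Pow U. ?c X * (\<Prod>i\<in>M'. ?h i (X \<inter> J i)))"
    unfolding card_out_split[OF assms(1)] by (simp add: power_add power_sum)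
  also have "\<dots> \<le> 2 ^ card (U - ?K) * (\<Prod>i\<in>M'. \<Sum>\<sigma>\<in>Pow (J i - I i). cmod (\<Sum>\<tau>\<in>Pow (I i). ?h i (\<sigma> \<union> \<tau>)))"
  proof (rule decoupling[OF fM' fin(1) _ IJ dJ])
    show "?c X = ?c Y" if eq: "X - (\<Union>i\<in>M'. I i) = Y - (\<Union>i\<in>M'. I i)" for X Y
    proof -
      have "F v X = F v Y" if v: "v \<in> V - (\<Union>i\<in>M'. N i)" for v
      proof (rule local)
        have "I v \<inter> I i = {}" if "i \<in> M'" for i using outer[OF M'[OF that]] v that by blast
        then show "X \<inter> I v = Y \<inter> I v" using eq by blast
      qed (use v in blast)
      then have "out F (V - (\<Union>i\<in>M'. N i)) X = out F (V - (\<Union>i\<in>M'. N i)) Y"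
        unfolding out_def by blast
      then show ?thesis by simp
    qed
  qed (use J(1) M' cmod_root_of_unity[OF z(1,2)] in \<open>auto simp: norm_power\<close>)
  also have "\<dots> \<le> 2 ^ card (U - ?K) * (\<Prod>i\<in>M'. 2 ^ card (J i) * exp (- (1 / (4 * real q ^ 2 * 2 ^ D))))"
  proof (intro mult_left_mono prod_mono conjI)
    fix i assume i: "i \<in> M'"
    have "(\<Sum>\<sigma>\<in>Pow (J i - I i). cmod (\<Sum>\<tau>\<in>Pow (I i). ?h i (\<sigma> \<union> \<tau>)))
        \<le> 2 ^ card (J i) * (1 - 1 / (4 * real q ^ 2 * 2 ^ D))"
    proof (rule uniform_block_bound[where i = i and F = F and N = "N i"])
      show "F i X = F i (X \<inter> I i)" for X
        using N(1) centre M'[OF i] by (intro local) auto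
    qed (use i M' finJ finN J(2) IJ centre unif z in auto)
    also have "\<dots> \<le> 2 ^ card (J i) * exp (- (1 / (4 * real q ^ 2 * 2 ^ D)))"
      using exp_ge_add_one_self[of "- (1 / (4 * real q ^ 2 * 2 ^ D))"] by (intro mult_left_mono) auto
    finally show "(\<Sum>\<sigma>\<in>Pow (J i - I i). cmod (\<Sum>\<tau>\<in>Pow (I i). ?h i (\<sigma> \<union> \<tau>)))
      \<le> 2 ^ card (J i) * exp (- (1 / (4 * real q ^ 2 * 2 ^ D)))" .
  qed (auto intro!: sum_nonneg)
  also have "\<dots> = 2 ^ card (U - ?K) * 2 ^ card ?K * exp (- (card M' / (4 * real q ^ 2 * 2 ^ D)))"
  proof -
    have "card ?K = (\<Sum>i\<in>M'. card (J i))"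
      using fM' finJ M' dJ by (intro card_UN_disjoint') auto
    then show ?thesis by (simp add: prod.distrib power_sum flip: exp_of_nat_mult)
  qed
  also have "2 ^ card (U - ?K) * 2 ^ card ?K = (2 ^ card U :: real)"
    using K fin by (metis card_Diff_subset card_mono le_add_diff_inverse2 power_add)
  finally show ?thesis .
qed

end

text \<open>The two characters with square 1 cannot be controlled, hence the parity term for even \<open>q\<close>.\<close>
definition main_term :: "nat \<Rightarrow> nat set \<Rightarrow> real" where
  "main_term q \<Lambda> = (if odd q then real (card \<Lambda>) / real q
          else 2 * real (max (card {l\<in>\<Lambda>. even l}) (card {l\<in>\<Lambda>. odd l})) / real q)"

section \<open>Fourier analysis modulo \<open>q\<close>\<close>

lemma root_of_unity_eq_1_iff:
  fixes q k :: nat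
  assumes "q > 0"
  shows "cis (2 * pi / q) ^ k = 1 \<longleftrightarrow> q dvd k"
  using complex_root_unity_eq_1[of q k] assms
  by (simp add: cis_conv_exp mult_ac flip: exp_of_nat_mult)

text \<open>Orthogonality of the characters of the integers mod \<open>q\<close>. The shift
  \<open>q - c\<close> replaces \<open>- c\<close>, which keeps all exponents natural.\<close>

lemma residue_indicator:
  assumes "q > 0" "c < q"
  shows "(of_bool (w mod q = c) :: complex) = (\<Sum>a<q. (cis (2 * pi / q) ^ a) ^ (w + (q - c))) / q"
proof -
  let ?z = "cis (2 * pi / q)" and ?k = "w + (q - c)"
  have "q dvd ?k \<longleftrightarrow> w mod q = c"
  proof -
    define r where "r = w mod q"
    have "?k = q * (w div q) + (r + (q - c))" by (simp add: r_def)
    then have "q dvd ?k \<longleftrightarrow> q dvd (r + (q - c))" by (metis dvd_add_right_iff dvd_triv_left)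
    also have "\<dots> \<longleftrightarrow> r = c"
    proof
      assume "q dvd r + (q - c)"
      then obtain k where k: "r + (q - c) = q * k" by blast
      have "r < q" using assms by (simp add: r_def)
      then have "0 < q * k" "q * k < q * 2" using k assms by linarith+
      then have "k = 1" by simp
      then show "r = c" using k assms by simp
    qed (use assms in simp)
    finally show ?thesis by (simp add: r_def)
  qed
  moreover have "(\<Sum>a<q. (?z ^ a) ^ ?k) = (\<Sum>a<q. (?z ^ ?k) ^ a)"
    by (simp flip: power_mult add: mult.commute)
  moreover have "(\<Sum>a<q. (?z ^ ?k) ^ a) = (if q dvd ?k then of_nat q else 0)"
  proof (cases "q dvd ?k")
    case True
    then show ?thesis using root_of_unity_eq_1_iff[OF assms(1), of ?k] by simp
  next
    case False
    then have "?z ^ ?k \<noteq> 1" using root_of_unity_eq_1_iff[OF assms(1), of ?k] by simp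
    moreover have "(?z ^ ?k) ^ q = 1"
      using root_of_unity_eq_1_iff[OF assms(1), of "?k * q"] by (simp add: power_mult)
    ultimately show ?thesis using False by (simp add: geometric_sum)
  qed
  ultimately show ?thesis using assms by simp
qed

text \<open>The condition is \<open>q dvd 2 * a\<close>, and \<open>a < q\<close> leaves the trivial
  character and, for even \<open>q\<close>, the parity character.\<close>

lemma real_characters:
  assumes "q > 0"
  shows "{a. a < q \<and> ((cis (2 * pi / q) ^ a)\<^sup>2 = 1)} = (if odd q then {0} else {0, q div 2})"
proof -
  have *: "(cis (2 * pi / q) ^ a)\<^sup>2 = 1 \<longleftrightarrow> q dvd 2 * a" for a
    using root_of_unity_eq_1_iff[OF assms, of "2 * a"] by (simp flip: power_mult add: mult.commute)
  have "q dvd 2 * a \<longleftrightarrow> a = 0 \<or> (even q \<and> a = q div 2)" if "a < q" for a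
  proof
    assume "q dvd 2 * a"
    then obtain k where k: "2 * a = q * k" by blast
    then have "q * k < q * 2" using that by linarith
    then have "k < 2" by simp
    then have "k = 0 \<or> k = 1" by auto
    then show "a = 0 \<or> (even q \<and> a = q div 2)" using k by auto
  qed auto
  then show ?thesis unfolding * using assms by auto
qed

text \<open>For odd \<open>q\<close> every residue contributes 1. For even \<open>q\<close> the
  parity character adds a sign, so a residue contributes 2 if its parity is that of \<open>w\<close>
  and 0 otherwise; the maximum over the two parities covers every \<open>w\<close>.\<close>

lemma real_character_sum_le:
  assumes "q \<ge> 3" "\<Lambda> \<subseteq> {..<q}"
  shows "(\<Sum>c\<in>\<Lambda>. \<Sum>a | a < q \<and> (cis (2 * pi / q) ^ a)\<^sup>2 = 1. Re ((cis (2 * pi / q) ^ a) ^ (w + (q - c)))) \<le> q * main_term q \<Lambda>"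
proof -
  have q: "q > 0" using assms by simp
  have finL: "finite \<Lambda>" using assms(2) finite_subset by blast
  show ?thesis
  proof (cases "odd q")
    case True
    then show ?thesis unfolding real_characters[OF q] main_term_def using assms by simp
  next
    case False
    then obtain h where h: "q = 2 * h" by (auto elim: evenE)
    then have h0: "h > 0" "0 \<noteq> h" using assms by auto
    have pi: "real h * (2 * pi / real q) = pi" using h h0 by (simp add: field_simps)
    have "cis (2 * pi / q) ^ h = cis (real h * (2 * pi / real q))" by (rule Complex.DeMoivre)
    then have "cis (2 * pi / q) ^ h = -1" unfolding pi by simp
    then have "(\<Sum>c\<in>\<Lambda>. \<Sum>a | a < q \<and> (cis (2 * pi / q) ^ a)\<^sup>2 = 1. Re ((cis (2 * pi / q) ^ a) ^ (w + (q - c))))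
       = (\<Sum>c\<in>\<Lambda>. 1 + Re ((-1) ^ (w + (q - c))))"
      unfolding real_characters[OF q] using False h h0 by simp
    also have "\<dots> = (\<Sum>c\<in>\<Lambda>. if even w = even c then 2 else 0)"
    proof (intro sum.cong refl)
      fix c assume "c \<in> \<Lambda>"
      then have "c \<le> q" using assms(2) by auto
      then have "even (w + (q - c)) \<longleftrightarrow> (even w = even c)" using False by simp
      then show "1 + Re ((-1) ^ (w + (q - c))) = (if even w = even c then 2 else 0)"
        by (cases "even (w + (q - c))") auto
    qed
    also have "\<dots> = 2 * real (card {c\<in>\<Lambda>. even w = even c})"
      using finL by (simp add: sum.If_cases Int_def)
    also have "\<dots> \<le> 2 * real (max (card {l\<in>\<Lambda>. even l}) (card {l\<in>\<Lambda>. odd l}))"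
      by (cases "even w") auto
    also have "\<dots> = q * main_term q \<Lambda>" using False q by (simp add: main_term_def)
    finally show ?thesis .
  qed
qed

context nonconnected_blocks
begin

text \<open>The indicator of the residue set is expanded in characters. Those with square 1 are
  bounded for each input separately and give the main term; the others are small on average by
  \<open>character_bound\<close>.\<close>

lemma weight_bound:
  assumes "M' \<subseteq> M" and unif: "\<And>i. i \<in> M' \<Longrightarrow> uniform_block (J i) F (N i)"
    and q: "q \<ge> 3" and L: "\<Lambda> \<subseteq> {..<q}"
  shows "(\<Sum>Y\<in>Pow V. law U F V Y * of_bool (card Y mod q \<in> \<Lambda>))
    \<le> main_term q \<Lambda> + q * exp (- (card M' / (4 * real q ^ 2 * 2 ^ D)))"
proof -
  define z where "z a = cis (2 * pi / q) ^ a" for a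
  define \<epsilon> where "\<epsilon> = exp (- (card M' / (4 * real q ^ 2 * 2 ^ D)))"
  define W where "W X = card (out F V X)" for X
  define A where "A = {a. a < q \<and> (z a)\<^sup>2 = 1}"
  have q0: "q > 0" using q by simp
  have finL: "finite \<Lambda>" "card \<Lambda> \<le> q"
    using L finite_subset card_mono[OF _ L] by auto
  have zq: "z a ^ q = 1" for a
    using root_of_unity_eq_1_iff[OF q0, of "a * q"] by (simp add: z_def power_mult)
  have ind: "real q * of_bool (w mod q \<in> \<Lambda>) = (\<Sum>c\<in>\<Lambda>. \<Sum>a<q. Re (z a ^ (w + (q - c))))" for w
  proof -
    have "real q * of_bool (w mod q \<in> \<Lambda>) = (\<Sum>c\<in>\<Lambda>. if w mod q = c then real q else 0)"
      using finL by (simp add: sum.delta)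
    also have "\<dots> = (\<Sum>c\<in>\<Lambda>. real q * of_bool (w mod q = c))"
      by (intro sum.cong) auto
    also have "\<dots> = (\<Sum>c\<in>\<Lambda>. Re (of_nat q * of_bool (w mod q = c)))"
      by (intro sum.cong refl) simp
    also have "\<dots> = (\<Sum>c\<in>\<Lambda>. \<Sum>a<q. Re (z a ^ (w + (q - c))))"
    proof (intro sum.cong refl)
      fix c assume "c \<in> \<Lambda>"
      then have "c < q" using L by auto
      show "Re (of_nat q * of_bool (w mod q = c)) = (\<Sum>a<q. Re (z a ^ (w + (q - c))))"
        unfolding residue_indicator[OF q0 \<open>c < q\<close>] z_def using q0 by simp
    qed
    finally show ?thesis .
  qed
  have split: "(\<Sum>a<q. g a) = (\<Sum>a\<in>A. g a) + (\<Sum>a\<in>{..<q} - A. g a)" for g :: "nat \<Rightarrow> real"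
    by (subst add.commute, rule sum.subset_diff) (auto simp: A_def)
  have small: "(\<Sum>X\<in>Pow U. Re (z a ^ (W X + (q - c)))) \<le> 2 ^ card U * \<epsilon>" if "a \<in> {..<q} - A" for a c
  proof -
    have "(\<Sum>X\<in>Pow U. Re (z a ^ (W X + (q - c)))) = Re (z a ^ (q - c) * (\<Sum>X\<in>Pow U. z a ^ W X))"
      unfolding sum_distrib_left Re_sum by (intro sum.cong refl) (simp only: power_add mult.commute)
    also have "\<dots> \<le> cmod (z a ^ (q - c) * (\<Sum>X\<in>Pow U. z a ^ W X))" by (rule complex_Re_le_cmod)
    also have "\<dots> = cmod (\<Sum>X\<in>Pow U. z a ^ W X)"
      using cmod_root_of_unity[OF zq q0] by (simp add: norm_mult norm_power)
    also have "\<dots> \<le> 2 ^ card U * \<epsilon>"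
      unfolding W_def \<epsilon>_def by (rule character_bound[OF assms(1) unif zq q0]) (use that in \<open>auto simp: A_def\<close>)
    finally show ?thesis .
  qed
  have "real q * (\<Sum>X\<in>Pow U. of_bool (W X mod q \<in> \<Lambda>) :: real)
     = (\<Sum>X\<in>Pow U. \<Sum>c\<in>\<Lambda>. \<Sum>a<q. Re (z a ^ (W X + (q - c))))"
    unfolding sum_distrib_left ind ..
  also have "\<dots> = (\<Sum>X\<in>Pow U. \<Sum>c\<in>\<Lambda>. \<Sum>a\<in>A. Re (z a ^ (W X + (q - c))))
      + (\<Sum>X\<in>Pow U. \<Sum>c\<in>\<Lambda>. \<Sum>a\<in>{..<q} - A. Re (z a ^ (W X + (q - c))))"
    unfolding split sum.distrib ..
  also have "(\<Sum>X\<in>Pow U. \<Sum>c\<in>\<Lambda>. \<Sum>a\<in>{..<q} - A. Re (z a ^ (W X + (q - c))))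
      = (\<Sum>c\<in>\<Lambda>. \<Sum>a\<in>{..<q} - A. \<Sum>X\<in>Pow U. Re (z a ^ (W X + (q - c))))"
    by (subst sum.swap, intro sum.cong refl, subst sum.swap) simp
  also have "\<dots> \<le> (\<Sum>c\<in>\<Lambda>. \<Sum>a\<in>{..<q} - A. 2 ^ card U * \<epsilon>)"
    by (intro sum_mono small)
  also have "\<dots> = real (card \<Lambda>) * real (card ({..<q} - A)) * (2 ^ card U * \<epsilon>)" by simp
  \<comment> \<open>At most \<open>q\<close> residues times at most \<open>q\<close> characters; the
    division by \<open>q\<close> from Fourier inversion leaves
    \<open>q * \<epsilon>\<close>.\<close>
  also have "\<dots> \<le> real q * real q * (2 ^ card U * \<epsilon>)"
  proof (intro mult_right_mono mult_mono)
    have "card ({..<q} - A) \<le> card {..<q}" by (intro card_mono) auto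
    then show "real (card ({..<q} - A)) \<le> real q" by simp
  qed (use finL in \<open>auto simp: \<epsilon>_def\<close>)
  also have "(\<Sum>X\<in>Pow U. \<Sum>c\<in>\<Lambda>. \<Sum>a\<in>A. Re (z a ^ (W X + (q - c)))) \<le> (\<Sum>X\<in>Pow U. q * main_term q \<Lambda>)"
    unfolding A_def z_def by (intro sum_mono real_character_sum_le q L)
  also have "\<dots> = real q * (2 ^ card U * main_term q \<Lambda>)" using fin by (simp add: card_Pow)
  finally have "real q * (\<Sum>X\<in>Pow U. of_bool (W X mod q \<in> \<Lambda>))
      \<le> real q * (2 ^ card U * (main_term q \<Lambda> + q * \<epsilon>))"
    by (simp add: algebra_simps)
  then have "(\<Sum>X\<in>Pow U. of_bool (W X mod q \<in> \<Lambda>)) \<le> 2 ^ card U * (main_term q \<Lambda> + q * \<epsilon>)"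
    using q0 by simp
  moreover have "(\<Sum>Y\<in>Pow V. law U F V Y * of_bool (card Y mod q \<in> \<Lambda>))
      = (\<Sum>X\<in>Pow U. of_bool (W X mod q \<in> \<Lambda>)) / 2 ^ card U"
    using sum_law[OF fin, of F "\<lambda>Y. of_bool (card Y mod q \<in> \<Lambda>) :: real"] by (simp add: W_def divide_inverse_commute)
  ultimately show ?thesis unfolding \<epsilon>_def by (simp add: divide_le_eq mult.commute)
qed

end

section \<open>Conditioning on a set of inputs\<close>

text \<open>Only the non-uniform centres are kept; being at least half of \<open>M\<close>, they
  cost a factor 2 in the exponent.\<close>

lemma (in nonconnected_blocks) affinity_bound:
  assumes "card M \<le> 2 * card {i\<in>M. \<not> uniform_block (J i) F (N i)}"
  shows "(\<Sum>Y\<in>Pow V. sqrt (law U F V Y * (1 / 2 ^ card V))) \<le> exp (- (card M / (16 * 4 ^ D)))"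
proof -
  let ?M = "{i\<in>M. \<not> uniform_block (J i) F (N i)}"
  have "(\<Sum>Y\<in>Pow V. sqrt (law U F V Y * (1 / 2 ^ card V))) \<le> exp (- (card ?M / (8 * 4 ^ D)))"
  proof (rule affinity_blocks[where J = J and N = N])
    show "disjoint_family_on J ?M" "disjoint_family_on N ?M"
      using J(3) N(3) by (auto simp: disjoint_family_on_def)
    show "F v X = F v (X \<inter> J i)" if "i \<in> ?M" "v \<in> N i" for i v X
      using that dep_block by blast
  qed (use fin finM J(1,2) N(1,2) in auto)
  also have "\<dots> \<le> exp (- (card M / (16 * 4 ^ D)))"
  proof -
    have "real (card M) \<le> 2 * real (card ?M)" using assms by linarith
    then show ?thesis by (simp add: field_simps)
  qed
  finally show ?thesis .
qed

text \<open>The law is the average over the values \<open>\<rho>\<close> of the bits in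
  \<open>S\<close>. Writing \<open>X - S\<close> makes the conditioned map ignore \<open>S\<close>
  for every argument, which the locality condition of the blocks quantifies over.\<close>

lemma law_condition:
  assumes "finite U" "S \<subseteq> U"
  shows "law U F V Y = (\<Sum>\<rho>\<in>Pow S. law (U - S) (\<lambda>v X. F v (\<rho> \<union> (X - S))) V Y / 2 ^ card S)"
proof -
  have out: "out (\<lambda>v X. F v (\<rho> \<union> (X - S))) V X = out F V (\<rho> \<union> X)" if "X \<in> Pow (U - S)" for X \<rho>
  proof -
    have "X - S = X" using that by blast
    then show ?thesis by (simp add: out_def)
  qed
  have "(2::real) ^ card U = 2 ^ card (U - S) * 2 ^ card S"
    using assms by (metis card_Diff_subset card_mono finite_subset le_add_diff_inverse2 power_add)
  moreover have "law (U - S) (\<lambda>v X. F v (\<rho> \<union> (X - S))) V Y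
    = (\<Sum>X\<in>Pow (U - S). of_bool (out F V (\<rho> \<union> X) = Y)) / 2 ^ card (U - S)" for \<rho>
    unfolding law_def by (intro arg_cong2[where f = "(/)"] sum.cong refl) (simp only: out)
  ultimately show ?thesis
    unfolding law_def[of U] sum_Pow_subset[OF assms] by (simp only: sum_divide_distrib divide_divide_eq_left)
qed

text \<open>\<open>min\<close> with a fixed cap is subadditive, and on the indices in
  \<open>A\<close> the cap is dropped. This lets the two cases of conditioning be bounded
  differently.\<close>

lemma min_sum_le:
  fixes a :: "'a \<Rightarrow> real"
  assumes "\<And>i. i \<in> T \<Longrightarrow> a i \<ge> 0" "u \<ge> 0"
  shows "min (\<Sum>i\<in>T. a i) u \<le> (\<Sum>i\<in>T. if i \<in> A then a i else min (a i) u)"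
  using assms(1)
proof (induction T rule: infinite_finite_induct)
  case (insert i T)
  have "0 \<le> (\<Sum>i\<in>T. a i)" using insert.prems by (intro sum_nonneg) auto
  moreover have "0 \<le> a i" using insert.prems by simp
  ultimately have "min (a i + (\<Sum>i\<in>T. a i)) u \<le> (if i \<in> A then a i else min (a i) u) + min (\<Sum>i\<in>T. a i) u"
    using \<open>u \<ge> 0\<close> by (auto simp: min_def)
  also have "\<dots> \<le> (if i \<in> A then a i else min (a i) u) + (\<Sum>i\<in>T. if i \<in> A then a i else min (a i) u)"
    using insert.IH insert.prems by (intro add_left_mono) simp
  finally show ?case using insert.hyps by simp
qed (use assms in auto)

lemma min_le_sqrt_mult:
  assumes "a \<ge> 0" "b \<ge> (0::real)"
  shows "min a b \<le> sqrt (a * b)"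
  by (rule real_le_rsqrt) (use assms in \<open>auto simp: min_def power2_eq_square intro: mult_left_mono mult_right_mono\<close>)

lemma main_term_nonneg: "main_term q \<Lambda> \<ge> 0"
  by (simp add: main_term_def)

text \<open>Values \<open>\<rho>\<close> with mostly uniform blocks keep their weight
  \<open>1 / 2 ^ card S\<close>, so the main term is only averaged. The other values are handled by
  a union bound, which costs the factor \<open>2 ^ card S\<close> but only on an exponentially small
  term.\<close>

lemma overlap_bound:
  fixes F :: "'b \<Rightarrow> 'a set \<Rightarrow> bool"
  assumes "finite U" "finite V" "S \<subseteq> U"
    and blocks: "\<And>\<rho>. \<rho> \<in> Pow S \<Longrightarrow>
      nonconnected_blocks (U - S) V (\<lambda>v. I v - S) (\<lambda>v X. F v (\<rho> \<union> (X - S))) M N J D"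
    and q: "q \<ge> 3" and L: "\<Lambda> \<subseteq> {..<q}"
    and ne: "{Y\<in>Pow V. card Y mod q \<in> \<Lambda>} \<noteq> {}"
  defines "E \<equiv> {Y\<in>Pow V. card Y mod q \<in> \<Lambda>}"
  shows "(\<Sum>Y\<in>Pow V. min (law U F V Y) (of_bool (Y \<in> E) / card E))
    \<le> main_term q \<Lambda> + q * exp (- (card M / (8 * real q ^ 2 * 2 ^ D)))
       + 2 ^ card V / card E * (2 ^ card S * exp (- (card M / (16 * 4 ^ D))))"
proof -
  define G where "G \<rho> = (\<lambda>v X. F v (\<rho> \<union> (X - S)))" for \<rho>
  define P where "P \<rho> = law (U - S) (G \<rho>) V" for \<rho>
  define good where "good \<rho> = {i\<in>M. uniform_block (J i) (G \<rho>) (N i)}" for \<rho>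
  define A where "A = {\<rho>. card M \<le> 2 * card (good \<rho>)}"
  define u where "u Y = of_bool (Y \<in> E) / real (card E)" for Y
  define \<alpha> where "\<alpha> = main_term q \<Lambda> + q * exp (- (card M / (8 * real q ^ 2 * 2 ^ D)))"
  define \<beta> where "\<beta> = 2 ^ card V / card E * exp (- (card M / (16 * 4 ^ D)))"
  have finS: "finite S" using assms finite_subset by blast
  have finE: "finite E" using assms by (simp add: E_def)
  have E: "card E > 0" "card E \<le> 2 ^ card V"
  proof -
    show "card E > 0" using finE ne by (simp add: E_def card_gt_0_iff)
    have "card E \<le> card (Pow V)" using assms by (intro card_mono) (auto simp: E_def)
    then show "card E \<le> 2 ^ card V" using assms by (simp add: card_Pow)
  qed
  have blocks': "nonconnected_blocks (U - S) V (\<lambda>v. I v - S) (G \<rho>) M N J D" if "\<rho> \<in> Pow S" for \<rho>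
    using blocks[OF that] unfolding G_def .
  have P0: "P \<rho> Y \<ge> 0" for \<rho> Y by (simp add: P_def law_nonneg)
  have u0: "u Y \<ge> 0" for Y by (simp add: u_def)
  have \<alpha>0: "\<alpha> \<ge> 0" by (simp add: \<alpha>_def main_term_nonneg)
  have \<beta>0: "\<beta> \<ge> 0" by (simp add: \<beta>_def)
  have pointwise: "min (law U F V Y) (u Y)
     \<le> (\<Sum>\<rho>\<in>Pow S. if \<rho> \<in> A then P \<rho> Y * of_bool (card Y mod q \<in> \<Lambda>) / 2 ^ card S else min (P \<rho> Y) (u Y))"
    (is "_ \<le> ?R") if "Y \<in> Pow V" for Y
  proof (cases "Y \<in> E")
    case True
    have "min (law U F V Y) (u Y) = min (\<Sum>\<rho>\<in>Pow S. P \<rho> Y / 2 ^ card S) (u Y)"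
      unfolding law_condition[OF assms(1,3)] P_def G_def ..
    also have "\<dots> \<le> (\<Sum>\<rho>\<in>Pow S. if \<rho> \<in> A then P \<rho> Y / 2 ^ card S else min (P \<rho> Y / 2 ^ card S) (u Y))"
      by (rule min_sum_le) (use P0 u0 in auto)
    also have "\<dots> \<le> ?R"
    proof (rule sum_mono)
      fix \<rho>
      have "P \<rho> Y / 2 ^ card S \<le> P \<rho> Y / 1" by (rule divide_left_mono) (use P0 in auto)
      then show "(if \<rho> \<in> A then P \<rho> Y / 2 ^ card S else min (P \<rho> Y / 2 ^ card S) (u Y))
        \<le> (if \<rho> \<in> A then P \<rho> Y * of_bool (card Y mod q \<in> \<Lambda>) / 2 ^ card S else min (P \<rho> Y) (u Y))"
        using True by (auto simp: E_def)
    qed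
    finally show ?thesis .
  next
    case False
    then have "u Y = 0" by (simp add: u_def)
    moreover have "?R \<ge> 0" by (intro sum_nonneg) (use P0 u0 in auto)
    ultimately show ?thesis by simp
  qed
  have A: "(\<Sum>Y\<in>Pow V. P \<rho> Y * of_bool (card Y mod q \<in> \<Lambda>)) \<le> \<alpha>" if "\<rho> \<in> Pow S" "\<rho> \<in> A" for \<rho>
  proof -
    interpret nonconnected_blocks "U - S" V "\<lambda>v. I v - S" "G \<rho>" M N J D by (rule blocks'[OF that(1)])
    have "(\<Sum>Y\<in>Pow V. P \<rho> Y * of_bool (card Y mod q \<in> \<Lambda>))
       \<le> main_term q \<Lambda> + q * exp (- (card (good \<rho>) / (4 * real q ^ 2 * 2 ^ D)))"
      unfolding P_def by (rule weight_bound[OF _ _ q L]) (auto simp: good_def)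
    also have "\<dots> \<le> \<alpha>"
    proof -
      have "real (card M) \<le> 2 * real (card (good \<rho>))" using that(2) by (simp add: A_def)
      then have "real (card M) / (8 * real q ^ 2 * 2 ^ D) \<le> 2 * real (card (good \<rho>)) / (8 * real q ^ 2 * 2 ^ D)"
        by (intro divide_right_mono) auto
      also have "\<dots> = real (card (good \<rho>)) / (4 * real q ^ 2 * 2 ^ D)" by simp
      finally show ?thesis unfolding \<alpha>_def by (intro add_left_mono mult_left_mono) auto
    qed
    finally show ?thesis .
  qed
  have B: "(\<Sum>Y\<in>Pow V. min (P \<rho> Y) (u Y)) \<le> \<beta>" if "\<rho> \<in> Pow S" "\<rho> \<notin> A" for \<rho>
  proof -
    interpret nonconnected_blocks "U - S" V "\<lambda>v. I v - S" "G \<rho>" M N J D by (rule blocks'[OF that(1)])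
    let ?r = "2 ^ card V / real (card E)"
    have r: "?r \<ge> 1"
    proof -
      have "real (card E) \<le> real (2 ^ card V)" using E(2) by (simp only: of_nat_le_iff)
      then show ?thesis using E(1) by simp
    qed
    \<comment> \<open>The target law is at most \<open>?r\<close>, the inverse density of its
      support, times the uniform law on all of \<open>Pow V\<close>, so the affinity with the latter
      suffices.\<close>
    have le: "min (P \<rho> Y) (u Y) \<le> ?r * sqrt (P \<rho> Y * (1 / 2 ^ card V))" for Y
    proof -
      have "u Y \<le> ?r * (1 / 2 ^ card V)" by (simp add: u_def)
      moreover have "P \<rho> Y \<le> ?r * P \<rho> Y" using mult_right_mono[OF r P0[of \<rho> Y]] by simp
      ultimately have "min (P \<rho> Y) (u Y) \<le> min (?r * P \<rho> Y) (?r * (1 / 2 ^ card V))" by (intro min.mono)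
      also have "\<dots> = ?r * min (P \<rho> Y) (1 / 2 ^ card V)" using r by (simp only: min_mult_distrib_left) simp
      also have "\<dots> \<le> ?r * sqrt (P \<rho> Y * (1 / 2 ^ card V))"
        using r P0 by (intro mult_left_mono min_le_sqrt_mult) auto
      finally show ?thesis .
    qed
    have "(\<Sum>Y\<in>Pow V. min (P \<rho> Y) (u Y)) \<le> ?r * (\<Sum>Y\<in>Pow V. sqrt (P \<rho> Y * (1 / 2 ^ card V)))"
      unfolding sum_distrib_left by (intro sum_mono le)
    also have "\<dots> \<le> ?r * exp (- (card M / (16 * 4 ^ D)))"
      unfolding P_def
    proof (intro mult_left_mono affinity_bound)
      have "{i\<in>M. \<not> uniform_block (J i) (G \<rho>) (N i)} = M - good \<rho>" by (auto simp: good_def)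
      moreover have "card (M - good \<rho>) = card M - card (good \<rho>)"
        using finM by (intro card_Diff_subset) (auto simp: good_def)
      ultimately show "card M \<le> 2 * card {i\<in>M. \<not> uniform_block (J i) (G \<rho>) (N i)}"
        using that(2) by (simp add: A_def)
    qed (use r in linarith)
    finally show ?thesis unfolding \<beta>_def .
  qed
  have "(\<Sum>Y\<in>Pow V. min (law U F V Y) (u Y))
     \<le> (\<Sum>Y\<in>Pow V. \<Sum>\<rho>\<in>Pow S. if \<rho> \<in> A then P \<rho> Y * of_bool (card Y mod q \<in> \<Lambda>) / 2 ^ card S else min (P \<rho> Y) (u Y))"
    by (intro sum_mono pointwise)
  also have "\<dots> = (\<Sum>\<rho>\<in>Pow S. \<Sum>Y\<in>Pow V. if \<rho> \<in> A then P \<rho> Y * of_bool (card Y mod q \<in> \<Lambda>) / 2 ^ card S else min (P \<rho> Y) (u Y))"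
    by (rule sum.swap)
  also have "\<dots> \<le> (\<Sum>\<rho>\<in>Pow S. \<alpha> / 2 ^ card S + \<beta>)"
  proof (rule sum_mono)
    fix \<rho> assume \<rho>: "\<rho> \<in> Pow S"
    show "(\<Sum>Y\<in>Pow V. if \<rho> \<in> A then P \<rho> Y * of_bool (card Y mod q \<in> \<Lambda>) / 2 ^ card S else min (P \<rho> Y) (u Y))
      \<le> \<alpha> / 2 ^ card S + \<beta>"
    proof (cases "\<rho> \<in> A")
      case True
      have "(\<Sum>Y\<in>Pow V. P \<rho> Y * of_bool (card Y mod q \<in> \<Lambda>)) / 2 ^ card S \<le> \<alpha> / 2 ^ card S"
        by (intro divide_right_mono A \<rho> True) simp
      then show ?thesis using True \<beta>0 by (simp add: sum_divide_distrib)
    next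
      case False
      have "0 \<le> \<alpha> / 2 ^ card S" using \<alpha>0 by simp
      then show ?thesis using B[OF \<rho> False] False by simp
    qed
  qed
  also have "\<dots> = \<alpha> + 2 ^ card S * \<beta>" using finS by (simp add: card_Pow distrib_left)
  finally show ?thesis unfolding \<alpha>_def \<beta>_def u_def by (simp add: mult_ac)
qed

section \<open>Elimination of inputs\<close>

text \<open>The threshold \<open>a j\<close> is the number of sets that must survive after
  \<open>j\<close> rounds. A maximal disjoint subfamily reaching \<open>a 0\<close> ends the
  process; otherwise its union is removed and the thresholds shift by one. After \<open>D\<close>
  rounds all sets are empty, hence disjoint.\<close>

lemma disjoint_elimination:
  fixes A :: "'i \<Rightarrow> 'a set" and a :: "nat \<Rightarrow> real"
  assumes "finite M" "\<And>i. i \<in> M \<Longrightarrow> finite (A i)" "\<And>i. i \<in> M \<Longrightarrow> card (A i) \<le> D"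
    and "a D \<le> card M"
  obtains j S M' where "j \<le> D" "S \<subseteq> (\<Union>i\<in>M. A i)" "M' \<subseteq> M" "disjoint_family_on (\<lambda>i. A i - S) M'"
    "a j \<le> card M'" "card S \<le> D * (\<Sum>i<j. a i)"
proof -
  \<comment> \<open>\<open>B\<close> keeps the original size bound while \<open>D\<close> decreases
    in the induction.\<close>
  have "\<exists>j S M'. j \<le> D \<and> S \<subseteq> (\<Union>i\<in>M. A i) \<and> M' \<subseteq> M \<and> disjoint_family_on (\<lambda>i. A i - S) M'
    \<and> a j \<le> card M' \<and> card S \<le> B * (\<Sum>i<j. a i)" if "D \<le> B" for B
    using assms that
  proof (induction D arbitrary: A a)
    case 0
    then have "disjoint_family_on A M" by (auto simp: disjoint_family_on_def)
    then show ?case using 0 by (intro exI[of _ 0] exI[of _ "{}"] exI[of _ M]) auto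
  next
    case (Suc D)
    have "\<exists>M0\<in>{M0 \<in> Pow M. disjoint_family_on A M0}. \<forall>M1\<in>{M0 \<in> Pow M. disjoint_family_on A M0}. M0 \<subseteq> M1 \<longrightarrow> M0 = M1"
      by (rule finite_has_maximal) (use Suc.prems(1) in \<open>auto simp: disjoint_family_on_def\<close>)
    then obtain M0 where M0: "M0 \<subseteq> M" "disjoint_family_on A M0"
      and max: "\<And>M1. M1 \<subseteq> M \<Longrightarrow> disjoint_family_on A M1 \<Longrightarrow> M0 \<subseteq> M1 \<Longrightarrow> M0 = M1" by auto
    show ?case
    proof (cases "a 0 \<le> card M0")
      case True
      then show ?thesis using M0 by (intro exI[of _ 0] exI[of _ "{}"] exI[of _ M0]) auto
    next
      case False
      define T where "T = (\<Union>i\<in>M0. A i)"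
      have fM0: "finite M0" using M0 Suc.prems(1) finite_subset by blast
      have finA: "finite (A i - T)" if "i \<in> M" for i using Suc.prems(2)[OF that] by blast
      \<comment> \<open>A set meeting \<open>T\<close> loses an element. A set missing
        \<open>T\<close> could be added to \<open>M0\<close>, so by maximality it belongs to
        \<open>M0\<close> and lies inside \<open>T\<close>.\<close>
      have small: "card (A i - T) \<le> D" if i: "i \<in> M" for i
      proof (cases "A i \<inter> T = {}")
        case True
        have "disjoint_family_on A (insert i M0)"
          using M0(2) True unfolding disjoint_family_on_def T_def by blast
        then have "i \<in> M0" using max[of "insert i M0"] i M0(1) by blast
        then have "A i - T = {}" unfolding T_def by blast
        then show ?thesis by (metis card.empty le0)
      next
        case False
        then have "A i - T \<subset> A i" by blast
        then have "card (A i - T) < card (A i)" using Suc.prems(2)[OF i] by (simp add: psubset_card_mono)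
        then show ?thesis using Suc.prems(3)[OF i] by linarith
      qed
      have "\<exists>j S M'. j \<le> D \<and> S \<subseteq> (\<Union>i\<in>M. A i - T) \<and> M' \<subseteq> M \<and> disjoint_family_on (\<lambda>i. (A i - T) - S) M'
        \<and> a (Suc j) \<le> card M' \<and> card S \<le> B * (\<Sum>i<j. a (Suc i))"
        by (rule Suc.IH[where A = "\<lambda>i. A i - T" and a = "\<lambda>i. a (Suc i)"]) (use Suc.prems(1,4,5) finA small in auto)
      then obtain j S M' where IH: "j \<le> D" "S \<subseteq> (\<Union>i\<in>M. A i - T)" "M' \<subseteq> M"
        "disjoint_family_on (\<lambda>i. (A i - T) - S) M'" "a (Suc j) \<le> card M'" "card S \<le> B * (\<Sum>i<j. a (Suc i))"
        by blast
      have "card T \<le> (\<Sum>i\<in>M0. card (A i))" unfolding T_def by (rule card_UN_le[OF fM0])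
      also have "\<dots> \<le> (\<Sum>i\<in>M0. B)"
      proof (rule sum_mono)
        fix i assume "i \<in> M0"
        then have "card (A i) \<le> Suc D" using Suc.prems(3) M0(1) by blast
        then show "card (A i) \<le> B" using Suc.prems(5) by linarith
      qed
      also have "\<dots> = B * card M0" by simp
      finally have "real (card T) \<le> real B * real (card M0)" by (metis of_nat_le_iff of_nat_mult)
      also have "\<dots> \<le> real B * a 0" using False by (intro mult_left_mono) auto
      finally have "real (card T) \<le> real B * a 0" .
      moreover have "real (card (T \<union> S)) \<le> real (card T) + real (card S)"
        by (metis card_Un_le of_nat_add of_nat_le_iff)
      ultimately have "real (card (T \<union> S)) \<le> real B * (\<Sum>i<Suc j. a i)"
        using IH(6) unfolding sum.lessThan_Suc_shift by (simp add: distrib_left)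
      moreover have "(\<lambda>i. A i - (T \<union> S)) = (\<lambda>i. (A i - T) - S)" by auto
      moreover have "T \<union> S \<subseteq> (\<Union>i\<in>M. A i)" using IH(2) M0(1) unfolding T_def by blast
      ultimately show ?thesis using IH
        by (intro exI[of _ "Suc j"] exI[of _ "T \<union> S"] exI[of _ M']) auto
    qed
  qed
  then show ?thesis using that by blast
qed

text \<open>Inserting \<open>i\<close> keeps the centre in its own neighbourhood even when all of
  its inputs lie in \<open>S\<close>.\<close>

definition nbhd :: "('b \<Rightarrow> 'a set) \<Rightarrow> 'b set \<Rightarrow> 'a set \<Rightarrow> 'b \<Rightarrow> 'b set" where
  "nbhd I V S i = insert i {v \<in> V. I v \<inter> I i - S \<noteq> {}}"

definition inputs :: "('b \<Rightarrow> 'a set) \<Rightarrow> 'b set \<Rightarrow> 'a set \<Rightarrow> 'b \<Rightarrow> 'a set" where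
  "inputs I V S i = (\<Union>v\<in>nbhd I V S i. I v) - S"

lemma nbhd_antimono: "S \<subseteq> T \<Longrightarrow> nbhd I V T i \<subseteq> nbhd I V S i"
  unfolding nbhd_def by blast

text \<open>Enlarging the removed set both deletes inputs and shrinks the neighbourhood, so
  disjointness outside the newly removed inputs carries over.\<close>

lemma inputs_antimono: "S \<subseteq> T \<Longrightarrow> inputs I V T i \<subseteq> inputs I V S i - T"
  using nbhd_antimono[of S T I V i] unfolding inputs_def by blast

text \<open>Double counting: the sets \<open>I i - S\<close> are disjoint, so every centre that
  \<open>v\<close> meets uses up a different element of \<open>I v\<close>, and \<open>v\<close> is
  counted at most \<open>d\<close> times.\<close>

lemma sum_nbhd_le:
  assumes "finite V" "M \<subseteq> V" "disjoint_family_on (\<lambda>i. I i - S) M"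
    and I: "\<And>v. v \<in> V \<Longrightarrow> finite (I v)" "\<And>v. v \<in> V \<Longrightarrow> card (I v) \<le> d"
  shows "(\<Sum>i\<in>M. card {v \<in> V. I v \<inter> I i - S \<noteq> {}}) \<le> card V * d"
proof -
  have fM: "finite M" using assms finite_subset by blast
  have "(\<Sum>i\<in>M. card {v \<in> V. I v \<inter> I i - S \<noteq> {}}) = (\<Sum>v\<in>V. card {i \<in> M. I v \<inter> I i - S \<noteq> {}})"
    using sum.swap_restrict[OF fM assms(1), of "\<lambda>_ _. 1::nat" "\<lambda>i v. I v \<inter> I i - S \<noteq> {}"] by simp
  also have "\<dots> \<le> (\<Sum>v\<in>V. d)"
  proof (rule sum_mono)
    fix v assume v: "v \<in> V"
    let ?M = "{i \<in> M. I v \<inter> I i - S \<noteq> {}}"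
    have fin: "finite (I v \<inter> I i - S)" for i using I(1)[OF v] by blast
    have "card ?M = (\<Sum>i\<in>?M. 1)" by simp
    also have "\<dots> \<le> (\<Sum>i\<in>?M. card (I v \<inter> I i - S))"
    proof (rule sum_mono)
      fix i assume "i \<in> ?M"
      then show "1 \<le> card (I v \<inter> I i - S)" using fin[of i] by (simp add: Suc_le_eq card_gt_0_iff)
    qed
    also have "\<dots> = card (\<Union>i\<in>?M. I v \<inter> I i - S)"
      by (rule card_UN_disjoint'[symmetric]) (use fM fin assms(3) in \<open>auto simp: disjoint_family_on_def\<close>)
    also have "\<dots> \<le> card (I v)" using I(1)[OF v] by (intro card_mono) auto
    also have "\<dots> \<le> d" by (rule I(2)[OF v])
    finally show "card ?M \<le> d" .
  qed
  finally show ?thesis by simp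
qed

text \<open>The point is that the neighbourhoods are disjoint: an output in two of them would have
  no inputs outside \<open>S\<close>, and such an output lies in a neighbourhood only as its
  centre.\<close>

lemma nonconnected_blocks_nbhd:
  fixes F :: "'b \<Rightarrow> 'a set \<Rightarrow> bool"
  assumes "finite U" "finite V" "\<And>v. v \<in> V \<Longrightarrow> I v \<subseteq> U"
    and local: "\<And>v X Y. v \<in> V \<Longrightarrow> X \<inter> I v = Y \<inter> I v \<Longrightarrow> F v X = F v Y"
    and M: "M \<subseteq> V" "\<And>i. i \<in> M \<Longrightarrow> card (nbhd I V S i) \<le> D" "\<And>i. i \<in> M \<Longrightarrow> card (inputs I V S i) \<le> D"
    and disj: "disjoint_family_on (inputs I V S) M"
  shows "nonconnected_blocks (U - S) V (\<lambda>v. I v - S) (\<lambda>v X. F v (\<rho> \<union> (X - S))) M (nbhd I V S) (inputs I V S) D"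
proof
  show "F v (\<rho> \<union> (X - S)) = F v (\<rho> \<union> (Y - S))"
    if "v \<in> V" "X \<inter> (I v - S) = Y \<inter> (I v - S)" for v X Y
    by (rule local[OF that(1)]) (use that(2) in blast)
  show "inputs I V S i \<subseteq> U - S" if "i \<in> M" for i
    using that M(1) assms(3) unfolding inputs_def nbhd_def by blast
  show "disjoint_family_on (nbhd I V S) M"
    unfolding disjoint_family_on_def
  proof (intro ballI impI, rule ccontr)
    fix i j assume ij: "i \<in> M" "j \<in> M" "i \<noteq> j" and "nbhd I V S i \<inter> nbhd I V S j \<noteq> {}"
    then obtain v where v: "v \<in> nbhd I V S i" "v \<in> nbhd I V S j" by blast
    then have "I v - S \<subseteq> inputs I V S i \<inter> inputs I V S j" unfolding inputs_def by blast
    then have "I v - S = {}" using disjoint_family_onD[OF disj ij] by blast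
    then show False using v ij(3) unfolding nbhd_def by blast
  qed
  show "I v - S \<subseteq> inputs I V S i" if "v \<in> nbhd I V S i" for i v
    using that unfolding inputs_def by blast
  show "(I v - S) \<inter> (I i - S) = {}" if "v \<in> V - nbhd I V S i" for i v
    using that unfolding nbhd_def by blast
qed (use assms in \<open>auto simp: nbhd_def\<close>)

section \<open>Growth of the tower function\<close>

lemma tow2_gt: "h < tow2 h"
proof (induction h)
  case (Suc h)
  have "tow2 h < tow2 (Suc h)" by simp
  then show ?case using Suc by linarith
qed simp

lemma tow2_mono: "h \<le> h' \<Longrightarrow> tow2 h \<le> tow2 h'"
proof (rule lift_Suc_mono_le[of tow2])
  show "tow2 n \<le> tow2 (Suc n)" for n by (simp add: less_imp_le)
qed

text \<open>\<open>K\<close> will be the threshold of the first elimination, \<open>D\<close> the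
  resulting bound on block inputs, and \<open>64 * 16 ^ D\<close> the ratio of the second. The
  product is at most 2 to a polynomial in \<open>K\<close>, which is below
  \<open>2 ^ (2 ^ K)\<close>.\<close>

lemma tower_step:
  assumes "1 \<le> d" "d + 4 \<le> h"
  defines "K \<equiv> tow2 h"
  defines "D \<equiv> d * (1 + 2 * d * K)"
  shows "2 * d\<^sup>2 * K * (64 * 16 ^ D) ^ (D + 1) \<le> tow2 (h + 2)"
proof -
  have dK: "d \<le> K" using tow2_gt[of h] assms by (simp add: K_def)
  \<comment> \<open>One level lower, \<open>K = 2 ^ e\<close> with \<open>e \<ge> 16\<close>; this
    gives \<open>74 \<le> K\<close> and \<open>K ^ 7 = 2 ^ (7 * e) \<le> 2 ^ K\<close>, which absorb
    the constants at the end.\<close>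
  obtain h' where h': "h = Suc h'" "h' \<ge> 4" using assms(1,2) by (cases h) auto
  define e where "e = tow2 h'"
  have "tow2 3 = 16" by (simp add: numeral_3_eq_3)
  then have e: "e \<ge> 16" using tow2_mono[of 3 h'] h'(2) by (simp add: e_def)
  have Ke: "K = 2 ^ e" by (simp add: K_def h' e_def)
  have "8 * n \<le> 2 ^ n" if "16 \<le> n" for n :: nat
    using that by (induction n rule: nat_induct_at_least) auto
  from this[OF e] have "8 * e \<le> K" by (simp add: Ke)
  have K74: "74 \<le> K" using \<open>8 * e \<le> K\<close> e by linarith
  have K1: "1 \<le> K" using K74 by simp
  have D: "D \<le> 3 * K ^ 3"
  proof -
    have "1 + 2 * d * K \<le> 3 * K ^ 2"
    proof -
      have "d * K \<le> K * K" using dK by (rule mult_le_mono1)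
      moreover have "1 \<le> K * K" using mult_le_mono[OF K1 K1] by simp
      moreover have "2 * d * K = 2 * (d * K)" by simp
      ultimately show ?thesis unfolding power2_eq_square by linarith
    qed
    then have "D \<le> K * (3 * K ^ 2)" unfolding D_def using dK by (intro mult_le_mono)
    then show ?thesis by (simp add: power3_eq_cube power2_eq_square mult_ac)
  qed
  have K3: "1 \<le> K ^ 3" using K1 by simp
  have "(64 * 16 ^ D :: nat) = 2 ^ (6 + 4 * D)"
    by (simp add: power_add power_mult)
  then have "(64 * 16 ^ D :: nat) ^ (D + 1) = 2 ^ ((6 + 4 * D) * (D + 1))"
    by (simp only: power_mult)
  also have "\<dots> \<le> 2 ^ (72 * K ^ 6)"
  proof (rule power_increasing)
    have "(6 + 4 * D) * (D + 1) \<le> (18 * K ^ 3) * (4 * K ^ 3)"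
      using D K3 by (intro mult_le_mono) linarith+
    also have "\<dots> = 72 * K ^ 6" by (simp flip: power_add)
    finally show "(6 + 4 * D) * (D + 1) \<le> 72 * K ^ 6" .
  qed simp
  finally have R: "(64 * 16 ^ D :: nat) ^ (D + 1) \<le> 2 ^ (72 * K ^ 6)" .
  have "2 * d\<^sup>2 * K \<le> 2 * K\<^sup>2 * K" using dK by (intro mult_le_mono power_mono) auto
  also have "\<dots> = 2 * K ^ 3" by (simp add: power3_eq_cube power2_eq_square)
  also have "\<dots> \<le> 2 * 2 ^ (K ^ 3)" using less_exp[of "K ^ 3"] by simp
  also have "\<dots> = 2 ^ (K ^ 3 + 1)" by simp
  also have "\<dots> \<le> 2 ^ (2 * K ^ 6)"
  proof (rule power_increasing)
    have "K ^ 3 \<le> K ^ 6" "1 \<le> K ^ 6" using K1 by (auto intro: power_increasing)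
    then show "K ^ 3 + 1 \<le> 2 * K ^ 6" by linarith
  qed simp
  finally have "2 * d\<^sup>2 * K * (64 * 16 ^ D) ^ (D + 1) \<le> 2 ^ (2 * K ^ 6) * 2 ^ (72 * K ^ 6)"
    using R by (rule mult_le_mono)
  also have "\<dots> = 2 ^ (74 * K ^ 6)" by (simp flip: power_add)
  also have "\<dots> \<le> 2 ^ (2 ^ K)"
  proof (rule power_increasing)
    have "74 * K ^ 6 \<le> K * K ^ 6" using K74 by (rule mult_le_mono1)
    also have "\<dots> = K ^ 7" by (simp add: eval_nat_numeral)
    also have "\<dots> = 2 ^ (7 * e)" by (simp add: Ke mult.commute flip: power_mult)
    also have "\<dots> \<le> 2 ^ K" using \<open>8 * e \<le> K\<close> by (intro power_increasing) auto
    finally show "74 * K ^ 6 \<le> 2 ^ K" .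
  qed simp
  also have "\<dots> = tow2 (h + 2)" by (simp add: K_def)
  finally show ?thesis .
qed

text \<open>The first elimination makes the centres' inputs disjoint, the second the inputs of whole
  neighbourhoods. Of the two numerical conclusions, the bound on \<open>card S\<close> pays for the
  union bound and the bound on \<open>card V\<close> gives the final exponent.\<close>

lemma exists_nonconnected_neighbourhoods:
  fixes I :: "'b \<Rightarrow> 'a set"
  assumes "finite U" "finite V" "1 \<le> d"
    and I: "\<And>v. v \<in> V \<Longrightarrow> I v \<subseteq> U" "\<And>v. v \<in> V \<Longrightarrow> card (I v) \<le> d"
  obtains S M D where "S \<subseteq> U" "M \<subseteq> V" "\<And>i. i \<in> M \<Longrightarrow> card (nbhd I V S i) \<le> D"
    "\<And>i. i \<in> M \<Longrightarrow> card (inputs I V S i) \<le> D" "disjoint_family_on (inputs I V S) M"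
    "real (card S) * (32 * 4 ^ D) \<le> card M" "real (card V) * (32 * 4 ^ D) \<le> real (card M) * real (tow2 (18 * d))"
proof -
  define n where "n = real (card V)"
  define h where "h j = 2 * (d - j) + d + 4" for j
  \<comment> \<open>The inputs removed at levels \<open>i < j\<close> must be few even against the exponentially smaller number of centres that survives at level \<open>j\<close>; \<open>tower_step\<close> shows that two exponentials per level suffice.\<close>
  define k where "k j = tow2 (h j)" for j
  have k1: "k j \<ge> 1" for j using tow2_gt[of "h j"] by (simp add: k_def)
  have finI: "finite (I v)" if "v \<in> V" for v using I(1)[OF that] assms(1) by (rule finite_subset)
  have "n / k d \<le> n / 1" using k1[of d] by (intro divide_left_mono) (auto simp: n_def)
  then have le: "n / k d \<le> card V" by (simp add: n_def)
  obtain j S0 M0 where j: "j \<le> d" and S0: "S0 \<subseteq> (\<Union>v\<in>V. I v)" and M0: "M0 \<subseteq> V"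
    "disjoint_family_on (\<lambda>i. I i - S0) M0" "n / k j \<le> card M0" "card S0 \<le> d * (\<Sum>i<j. n / k i)"
    by (rule disjoint_elimination[where a = "\<lambda>j. n / k j", OF assms(2) finI I(2) le]) (assumption | rule that)+
  define K where "K = k j"
  \<comment> \<open>The Markov threshold; the summand 1 counts the centre itself. Each of the
    \<open>t\<close> outputs reads at most \<open>d\<close> inputs, hence \<open>D\<close>.\<close>
  define t where "t = 1 + 2 * d * K"
  define D where "D = d * t"
  \<comment> \<open>Chosen as \<open>(2 * 4 ^ D) * (32 * 4 ^ D)\<close>: the first factor dominates
    \<open>real D ^ 2 + 1\<close>, the second is the required margin between \<open>card S\<close>
    and the number of centres.\<close>
  define R where "R = (64 * 16 ^ D :: real)"
  have K1: "K \<ge> 1" using k1 by (simp add: K_def)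
  have R1: "R \<ge> 1" using one_le_power[of "16::real" D] unfolding R_def by linarith
  have tD: "t \<le> D" using assms(3) by (simp add: D_def)
  have finV: "finite M0" using M0(1) assms(2) by (rule finite_subset)

  \<comment> \<open>Disjointness of the input sets bounds the total size of the neighbourhoods by \<open>n * d\<close>, so Markov's inequality leaves half of the centres.\<close>
  define M1 where "M1 = {i \<in> M0. card (nbhd I V S0 i) \<le> t}"
  have M1: "n / (2 * K) \<le> card M1"
  proof -
    let ?c = "\<lambda>i. card {v \<in> V. I v \<inter> I i - S0 \<noteq> {}}"
    have big: "2 * d * K \<le> ?c i" if "i \<in> M0 - M1" for i
    proof -
      have "card (nbhd I V S0 i) \<le> Suc (?c i)" unfolding nbhd_def by (rule card_insert_le_m1) auto
      then show ?thesis using that by (auto simp: M1_def t_def)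
    qed
    have "card (M0 - M1) * (2 * d * K) = (\<Sum>i\<in>M0 - M1. 2 * d * K)" by simp
    also have "\<dots> \<le> (\<Sum>i\<in>M0 - M1. ?c i)" by (rule sum_mono) (rule big)
    also have "\<dots> \<le> (\<Sum>i\<in>M0. ?c i)" using finV by (intro sum_mono2) auto
    also have "\<dots> \<le> card V * d" by (rule sum_nbhd_le[OF assms(2) M0(1,2) finI I(2)])
    finally have "card (M0 - M1) * (2 * K) * d \<le> card V * d" by (simp add: mult_ac)
    then have "card (M0 - M1) * (2 * K) \<le> card V" using assms(3) by simp
    then have "real (card (M0 - M1)) * (2 * K) \<le> n" unfolding n_def
      by (metis of_nat_le_iff of_nat_mult of_nat_numeral)
    then have "real (card (M0 - M1)) \<le> n / (2 * K)" using K1 by (simp add: le_divide_eq)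
    moreover have "real (card M0) = real (card (M0 - M1)) + real (card M1)"
    proof -
      have "M1 \<subseteq> M0" by (auto simp: M1_def)
      then have "card M0 = card (M0 - M1) + card M1"
        using finV by (metis card_Diff_subset card_mono finite_subset le_add_diff_inverse2)
      then show ?thesis by simp
    qed
    moreover have "n / K = 2 * (n / (2 * K))" by simp
    ultimately show ?thesis using M0(3) unfolding K_def by linarith
  qed
  have M1V: "M1 \<subseteq> V" using M0(1) by (auto simp: M1_def)
  have nbhdV: "nbhd I V S i \<subseteq> V" if "i \<in> V" for S i using that by (auto simp: nbhd_def)
  have fin_nbhd: "finite (nbhd I V S i)" if "i \<in> V" for S i
    using nbhdV[OF that] assms(2) by (rule finite_subset)
  have inputsU: "inputs I V S i \<subseteq> U" if "i \<in> V" for S i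
    using nbhdV[OF that, of S] I(1) unfolding inputs_def by blast
  have fin_inputs: "finite (inputs I V S i)" if "i \<in> V" for S i
    using inputsU[OF that] assms(1) by (rule finite_subset)
  have card_inputs: "card (inputs I V S0 i) \<le> D" if i: "i \<in> M1" for i
  proof -
    have iV: "i \<in> V" using i M1V by blast
    have "card (inputs I V S0 i) \<le> card (\<Union>v\<in>nbhd I V S0 i. I v)"
      unfolding inputs_def using fin_nbhd[OF iV] nbhdV[OF iV] finI by (intro card_mono) auto
    also have "\<dots> \<le> (\<Sum>v\<in>nbhd I V S0 i. card (I v))" by (rule card_UN_le[OF fin_nbhd[OF iV]])
    also have "\<dots> \<le> (\<Sum>v\<in>nbhd I V S0 i. d)" by (rule sum_mono) (use I(2) nbhdV[OF iV] in blast)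
    also have "\<dots> = d * card (nbhd I V S0 i)" by simp
    also have "\<dots> \<le> D" unfolding D_def using i by (intro mult_le_mono) (auto simp: M1_def)
    finally show ?thesis .
  qed
  \<comment> \<open>A second elimination, now on the inputs of whole neighbourhoods: a geometric progression of thresholds suffices because the neighbourhoods are already bounded.\<close>
  define a where "a l = card M1 / R ^ (D - l)" for l
  have aD: "a D \<le> card M1" by (simp add: a_def)
  have finM1: "finite M1" using M1V assms(2) by (rule finite_subset)
  have finA: "finite (inputs I V S0 i)" if "i \<in> M1" for i using fin_inputs that M1V by blast
  obtain l S1 M where l: "l \<le> D" and S1: "S1 \<subseteq> (\<Union>i\<in>M1. inputs I V S0 i)" and M: "M \<subseteq> M1"
    "disjoint_family_on (\<lambda>i. inputs I V S0 i - S1) M" "a l \<le> card M" "card S1 \<le> D * (\<Sum>i<l. a i)"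
    by (rule disjoint_elimination[where a = a, OF finM1 finA card_inputs aD]) (assumption | rule that)+
  have al0: "a l \<ge> 0" using R1 by (simp add: a_def)
  \<comment> \<open>At most \<open>D\<close> earlier thresholds, each at most
    \<open>a l / R\<close>; the other factor \<open>D\<close> bounds the size of the removed
    sets.\<close>
  have card_S1: "card S1 \<le> real D ^ 2 * (a l / R)"
  proof -
    have "(\<Sum>i<l. a i) \<le> (\<Sum>i<l. a l / R)"
    proof (rule sum_mono)
      fix i assume "i \<in> {..<l}"
      then have "R ^ (D - l + 1) \<le> R ^ (D - i)" using l R1 by (intro power_increasing) auto
      then have "card M1 / R ^ (D - i) \<le> card M1 / R ^ (D - l + 1)"
        using R1 by (intro divide_left_mono) auto
      then show "a i \<le> a l / R" by (simp add: a_def mult.commute)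
    qed
    also have "\<dots> = l * (a l / R)" by simp
    also have "\<dots> \<le> D * (a l / R)" using l al0 R1 by (intro mult_right_mono) auto
    finally have "D * (\<Sum>i<l. a i) \<le> D * (D * (a l / R))" by (intro mult_left_mono) auto
    then show ?thesis using M(4) by (simp add: power2_eq_square mult.assoc)
  qed
  have step: "2 * d\<^sup>2 * K * R ^ (D + 1) \<le> tow2 (h j + 2)"
  proof -
    have "2 * d\<^sup>2 * K * (64 * 16 ^ D) ^ (D + 1) \<le> tow2 (h j + 2)"
      unfolding K_def D_def t_def k_def by (rule tower_step) (use assms(3) in \<open>auto simp: h_def\<close>)
    then have "real (2 * d\<^sup>2 * K * (64 * 16 ^ D) ^ (D + 1)) \<le> real (tow2 (h j + 2))"
      by (simp only: of_nat_le_iff)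
    then show ?thesis by (simp add: R_def)
  qed
  \<comment> \<open>The total loss of centres: \<open>2 * K\<close> up to \<open>M1\<close>, then at
    most \<open>R ^ D\<close> in the second elimination.\<close>
  have n_le: "n \<le> 2 * K * R ^ D * a l"
  proof -
    have "n \<le> 2 * real K * real (card M1)" using M1 K1 by (simp add: divide_le_eq mult.commute)
    moreover have "real (card M1) \<le> R ^ D * a l"
    proof -
      have "R ^ D = R ^ (D - l) * R ^ l" using l by (simp flip: power_add)
      then have "R ^ D * a l = R ^ l * card M1" using R1 by (simp add: a_def)
      moreover have "1 \<le> R ^ l" using R1 by (rule one_le_power)
      ultimately show ?thesis by (simp add: mult_le_cancel_right1)
    qed
    then have "2 * real K * real (card M1) \<le> 2 * real K * (R ^ D * a l)" by (rule mult_left_mono) simp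
    ultimately show ?thesis by (simp add: mult.assoc)
  qed
  \<comment> \<open>Inputs removed in the first elimination must be few against the centres left
    after the second, so each earlier threshold needs a bound with \<open>d\<^sup>2\<close>: one
    \<open>d\<close> for the levels, one for the size of the sets.\<close>
  have card_S0: "card S0 \<le> a l / R"
  proof -
    have "n / k i \<le> a l / (d\<^sup>2 * R)" if "i \<in> {..<j}" for i
    proof -
      have "tow2 (h j + 2) \<le> k i" unfolding k_def by (rule tow2_mono) (use that j in \<open>auto simp: h_def\<close>)
      then have "2 * d\<^sup>2 * K * R ^ (D + 1) \<le> k i" using step by linarith
      then have "n * (2 * d\<^sup>2 * K * R ^ (D + 1)) \<le> (2 * K * R ^ D * a l) * k i"
        using n_le al0 R1 by (intro mult_mono) (auto simp: n_def)
      then have "(n * (d\<^sup>2 * R)) * (2 * K * R ^ D) \<le> (a l * k i) * (2 * K * R ^ D)"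
        by (simp add: mult_ac)
      then have "n * (d\<^sup>2 * R) \<le> a l * k i"
        using K1 R1 by (subst (asm) mult_le_cancel_right_pos) auto
      then show ?thesis using k1[of i] assms(3) R1 by (simp add: field_simps)
    qed
    then have "(\<Sum>i<j. n / k i) \<le> (\<Sum>i<j. a l / (d\<^sup>2 * R))" by (rule sum_mono)
    also have "\<dots> = j * (a l / (d\<^sup>2 * R))" by simp
    also have "\<dots> \<le> d * (a l / (d\<^sup>2 * R))" using j al0 R1 by (intro mult_right_mono) auto
    finally have "d * (\<Sum>i<j. n / k i) \<le> d * (d * (a l / (d\<^sup>2 * R)))" by (intro mult_left_mono) auto
    also have "\<dots> = a l / R" using assms(3) by (simp add: power2_eq_square)
    finally show ?thesis using M0(4) by linarith
  qed
  define S where "S = S0 \<union> S1"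
  have sub: "nbhd I V S i \<subseteq> nbhd I V S0 i" "inputs I V S i \<subseteq> inputs I V S0 i - S1" for i
    using nbhd_antimono[of S0 S I V i] inputs_antimono[of S0 S I V i] by (auto simp: S_def)
  have D2: "(real D ^ 2 + 1) * (32 * 4 ^ D) \<le> R"
  proof -
    have "D < 2 ^ D" by (rule less_exp)
    then have "real D \<le> 2 ^ D" by (metis less_imp_le of_nat_le_iff of_nat_numeral of_nat_power)
    then have "real D ^ 2 \<le> (2 ^ D)\<^sup>2" by (intro power_mono) auto
    also have "((2::real) ^ D)\<^sup>2 = (2\<^sup>2) ^ D" by (simp only: power_mult[symmetric] mult.commute)
    also have "\<dots> = 4 ^ D" by simp
    finally have "real D ^ 2 + 1 \<le> 2 * 4 ^ D" using one_le_power[of "4::real" D] by linarith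
    then have "(real D ^ 2 + 1) * (32 * 4 ^ D) \<le> (2 * 4 ^ D) * (32 * 4 ^ D)" by (rule mult_right_mono) simp
    also have "\<dots> = R" by (simp add: R_def flip: power_mult_distrib)
    finally show ?thesis .
  qed
  show ?thesis
  proof
    have iV: "i \<in> V" "i \<in> M1" if "i \<in> M" for i using that M(1) M1V by auto
    show "S \<subseteq> U" using S0 S1 I(1) inputsU M1V unfolding S_def by blast
    show "M \<subseteq> V" using M(1) M1V by blast
    show "card (nbhd I V S i) \<le> D" if "i \<in> M" for i
    proof -
      have "card (nbhd I V S i) \<le> card (nbhd I V S0 i)" by (rule card_mono[OF fin_nbhd[OF iV(1)[OF that]] sub(1)])
      then show ?thesis using iV(2)[OF that] tD by (simp add: M1_def)
    qed
    show "card (inputs I V S i) \<le> D" if "i \<in> M" for i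
    proof -
      have "card (inputs I V S i) \<le> card (inputs I V S0 i)"
        by (rule card_mono[OF fin_inputs[OF iV(1)[OF that]]]) (use sub(2) in blast)
      then show ?thesis using card_inputs[OF iV(2)[OF that]] by linarith
    qed
    show "disjoint_family_on (inputs I V S) M"
      using M(2) sub(2) unfolding disjoint_family_on_def by blast
    have "real (card S) \<le> real (card S0) + real (card S1)"
      unfolding S_def by (metis card_Un_le of_nat_add of_nat_le_iff)
    also have "\<dots> \<le> (real D ^ 2 + 1) * (a l / R)" using card_S0 card_S1 unfolding distrib_right by linarith
    finally have "real (card S) * (32 * 4 ^ D) \<le> (real D ^ 2 + 1) * (a l / R) * (32 * 4 ^ D)"
      by (rule mult_right_mono) simp
    also have "\<dots> = (real D ^ 2 + 1) * (32 * 4 ^ D) * (a l / R)" by simp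
    also have "\<dots> \<le> R * (a l / R)" by (rule mult_right_mono[OF D2]) (use al0 R1 in simp)
    also have "\<dots> = a l" using R1 by simp
    finally show "real (card S) * (32 * 4 ^ D) \<le> card M" using M(3) by linarith
    have R32: "32 * 4 ^ D \<le> R"
    proof -
      have "1 * (32 * 4 ^ D) \<le> (real D ^ 2 + 1) * (32 * 4 ^ D)" by (intro mult_right_mono) auto
      then show ?thesis using D2 by linarith
    qed
    have "n * (32 * 4 ^ D) \<le> (2 * K * R ^ D * a l) * R"
      by (rule mult_mono[OF n_le R32]) (use al0 R1 in auto)
    also have "\<dots> = a l * (1 * (2 * K * R ^ (D + 1)))" by simp
    also have "\<dots> \<le> a l * (real (d\<^sup>2) * (2 * K * R ^ (D + 1)))"
      using al0 R1 assms(3) by (intro mult_left_mono mult_right_mono) auto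
    also have "\<dots> = a l * (2 * d\<^sup>2 * K * R ^ (D + 1))" by simp
    also have "\<dots> \<le> real (card M) * real (tow2 (h j + 2))" by (rule mult_mono[OF M(3) step]) (use R1 in auto)
    also have "\<dots> \<le> real (card M) * real (tow2 (18 * d))"
    proof -
      \<comment> \<open>The largest value is \<open>3 * d + 6\<close>, at \<open>j = 0\<close>; it
        fits because \<open>1 \<le> d\<close>.\<close>
      have "h j + 2 \<le> 18 * d" using assms(3) by (simp add: h_def)
      then have "tow2 (h j + 2) \<le> tow2 (18 * d)" by (rule tow2_mono)
      then show ?thesis by (intro mult_left_mono) (simp_all only: of_nat_le_iff of_nat_0_le_iff)
    qed
    finally show "real (card V) * (32 * 4 ^ D) \<le> real (card M) * real (tow2 (18 * d))" by (simp add: n_def)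
  qed
qed

section \<open>Distributions on the cube\<close>

definition bits :: "nat \<Rightarrow> nat set \<Rightarrow> bool list" where
  "bits n X = map (\<lambda>j. j \<in> X) [0..<n]"

definition support :: "bool list \<Rightarrow> nat set" where
  "support x = {j. j < length x \<and> x ! j}"

lemma bits_support: "bits (length x) (support x) = x"
  by (rule nth_equalityI) (auto simp: bits_def support_def)

lemma support_bits: "X \<subseteq> {..<n} \<Longrightarrow> support (bits n X) = X"
  by (auto simp: bits_def support_def)

lemma bij_betw_bits: "bij_betw (bits n) (Pow {..<n}) (cube n)"
proof (rule bij_betw_byWitness[where f' = support])
  show "\<forall>X\<in>Pow {..<n}. support (bits n X) = X" using support_bits by blast
  show "\<forall>x\<in>cube n. bits n (support x) = x" using bits_support by (auto simp: cube_def)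
  show "bits n ` Pow {..<n} \<subseteq> cube n" by (auto simp: bits_def cube_def)
  show "support ` cube n \<subseteq> Pow {..<n}" by (auto simp: support_def cube_def)
qed

lemma hweight_bits:
  assumes "X \<subseteq> {..<n}"
  shows "hweight (bits n X) = card X"
proof -
  have "hweight (bits n X) = length (filter (\<lambda>j. j \<in> X) [0..<n])"
    by (simp add: hweight_def bits_def filter_map o_def)
  also have "\<dots> = card ({j. j \<in> X} \<inter> {..<n})"
    by (simp add: distinct_length_filter atLeast0LessThan)
  also have "{j. j \<in> X} \<inter> {..<n} = X" using assms by blast
  finally show ?thesis .
qed

lemma sum_cube: "(\<Sum>x\<in>cube n. g x) = (\<Sum>X\<in>Pow {..<n}. g (bits n X))"
  by (rule sum.reindex_bij_betw[OF bij_betw_bits, symmetric])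

lemma finite_cube: "finite (cube n)"
  using bij_betw_finite[OF bij_betw_bits] by simp

lemma card_cube: "card (cube n) = 2 ^ n"
  using bij_betw_same_card[OF bij_betw_bits, of n] by (simp add: card_Pow)

text \<open>A lower bound on the distance thus amounts to an upper bound on the overlap.\<close>

lemma tv_dist_eq:
  assumes "(\<Sum>y\<in>cube n. P y) = 1" "(\<Sum>y\<in>cube n. Q y) = 1"
  shows "tv_dist n P Q = 1 - (\<Sum>y\<in>cube n. min (P y) (Q y))"
proof -
  have "\<bar>P y - Q y\<bar> = P y + Q y - 2 * min (P y) (Q y)" for y by (simp add: min_def)
  then show ?thesis
    using assms by (simp add: tv_dist_def sum.distrib sum_subtractf flip: sum_distrib_left)
qed

section \<open>Total masses and the support of the target distribution\<close>

lemma sum_push_unif: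
  assumes "\<And>x. x \<in> cube m \<Longrightarrow> f x \<in> cube n"
  shows "(\<Sum>y\<in>cube n. push_unif f m y) = 1"
proof -
  have "(\<Sum>y\<in>cube n. card {x \<in> cube m. f x = y}) = card (cube m)"
    using sum.group[OF finite_cube finite_cube, of f m n "\<lambda>_. 1::nat"] assms by auto
  then have "real (\<Sum>y\<in>cube n. card {x \<in> cube m. f x = y}) = real (2 ^ m)"
    by (simp only: card_cube)
  then have "(\<Sum>y\<in>cube n. real (card {x \<in> cube m. f x = y})) = 2 ^ m"
    by simp
  then show ?thesis by (simp add: push_unif_def flip: sum_divide_distrib)
qed

lemma supp_D_eq: "supp_D n q \<Lambda> = bits n ` {Y \<in> Pow {..<n}. card Y mod q \<in> \<Lambda>}"
proof -
  have "cube n = bits n ` Pow {..<n}" using bij_betw_bits by (auto simp: bij_betw_def)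
  then show ?thesis by (auto simp: supp_D_def hweight_bits)
qed

lemma card_supp_D: "card (supp_D n q \<Lambda>) = card {Y \<in> Pow {..<n}. card Y mod q \<in> \<Lambda>}"
  unfolding supp_D_eq
proof (rule card_image, rule inj_on_subset)
  show "inj_on (bits n) (Pow {..<n})" using bij_betw_bits by (rule bij_betw_imp_inj_on)
qed blast

lemma finite_supp_D: "finite (supp_D n q \<Lambda>)"
  by (simp add: supp_D_def finite_cube)

lemma supp_D_nonempty:
  assumes "q \<le> n" "\<Lambda> \<subseteq> {..<q}" "\<Lambda> \<noteq> {}"
  shows "{Y \<in> Pow {..<n}. card Y mod q \<in> \<Lambda>} \<noteq> {}"
proof -
  obtain c where "c \<in> \<Lambda>" using assms(3) by blast
  \<comment> \<open>A set of size \<open>c\<close> fits into \<open>{..<n}\<close> because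
    \<open>c < q\<close> and \<open>q \<le> n\<close>.\<close>
  then have "{..<c} \<in> {Y \<in> Pow {..<n}. card Y mod q \<in> \<Lambda>}" using assms by auto
  then show ?thesis by blast
qed

lemma sum_D_dist:
  assumes "supp_D n q \<Lambda> \<noteq> {}"
  shows "(\<Sum>y\<in>cube n. D_dist n q \<Lambda> y) = 1"
proof -
  have "supp_D n q \<Lambda> \<subseteq> cube n" by (auto simp: supp_D_def)
  then have "(\<Sum>y\<in>cube n. D_dist n q \<Lambda> y) = (\<Sum>y\<in>supp_D n q \<Lambda>. 1 / real (card (supp_D n q \<Lambda>)))"
    using finite_cube unfolding D_dist_def by (simp add: sum.If_cases Int_absorb1)
  then show ?thesis using assms finite_supp_D by simp
qed

text \<open>A constant map puts all mass on one point, where the target law has at most the weight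
  of one support element. This settles \<open>d = 0\<close>.\<close>

lemma constant_overlap:
  assumes "\<And>x. x \<in> cube m \<Longrightarrow> f x = y0"
  shows "(\<Sum>y\<in>cube n. min (push_unif f m y) (D_dist n q \<Lambda> y)) \<le> 1 / real (card (supp_D n q \<Lambda>))"
proof -
  have "min (push_unif f m y) (D_dist n q \<Lambda> y) \<le> (if y = y0 then 1 / real (card (supp_D n q \<Lambda>)) else 0)" for y
  proof (cases "y = y0")
    case True
    have "D_dist n q \<Lambda> y \<le> 1 / real (card (supp_D n q \<Lambda>))" by (simp add: D_dist_def)
    then show ?thesis using True by (simp add: min.coboundedI2)
  next
    case False
    then have "{x \<in> cube m. f x = y} = {}" using assms by auto
    then have "push_unif f m y = 0" by (simp only: push_unif_def) simp
    then show ?thesis using False by (simp add: D_dist_def)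
  qed
  then have "(\<Sum>y\<in>cube n. min (push_unif f m y) (D_dist n q \<Lambda> y))
    \<le> (\<Sum>y\<in>cube n. if y = y0 then 1 / real (card (supp_D n q \<Lambda>)) else 0)" by (rule sum_mono)
  also have "\<dots> \<le> 1 / real (card (supp_D n q \<Lambda>))" using finite_cube by simp
  finally show ?thesis .
qed

section \<open>Assembly of the overlap bound\<close>

lemma power_2_le_exp: "2 ^ s \<le> exp (real s)"
proof -
  have "(2::real) ^ s \<le> exp 1 ^ s" using exp_ge_add_one_self[of 1] by (intro power_mono) auto
  then show ?thesis by (simp flip: exp_of_nat_mult)
qed

text \<open>Strings are translated into sets of true positions, the elimination supplies centres,
  and both exponential errors of \<open>overlap_bound\<close> are compared with the target
  exponential \<open>e\<close>.\<close>

lemma local_overlap: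
  assumes "q \<ge> 3" "q \<le> n" "\<Lambda> \<subseteq> {..<q}" "\<Lambda> \<noteq> {}" "local_fun m n d f" "d \<ge> 1"
  shows "(\<Sum>y\<in>cube n. min (push_unif f m y) (D_dist n q \<Lambda> y))
    \<le> main_term q \<Lambda> + (6 * real q / (real (card (supp_D n q \<Lambda>)) / 2 ^ n))
           * exp (- (real n / (real q ^ 2 * real (tow2 (18 * d)))))"
proof -
  let ?U = "{..<m}" and ?V = "{..<n}"
  define F where "F v X = f (bits m X) ! v" for v X
  define E where "E = {Y \<in> Pow ?V. card Y mod q \<in> \<Lambda>}"
  define T where "T = real (tow2 (18 * d))"
  define e where "e = exp (- (n / (real q ^ 2 * T)))"
  have f: "f (bits m X) \<in> cube n" for X
    using assms(5) by (simp add: local_fun_def cube_def bits_def)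
  obtain I where I: "\<And>v. v \<in> ?V \<Longrightarrow> I v \<subseteq> ?U" "\<And>v. v \<in> ?V \<Longrightarrow> card (I v) \<le> d"
    and dep: "\<And>v x y. v \<in> ?V \<Longrightarrow> x \<in> cube m \<Longrightarrow> y \<in> cube m \<Longrightarrow> (\<And>j. j \<in> I v \<Longrightarrow> x ! j = y ! j) \<Longrightarrow> f x ! v = f y ! v"
  proof -
    have "\<forall>v. \<exists>S. v < n \<longrightarrow> S \<subseteq> ?U \<and> card S \<le> d \<and>
        (\<forall>x\<in>cube m. \<forall>y\<in>cube m. (\<forall>j\<in>S. x ! j = y ! j) \<longrightarrow> f x ! v = f y ! v)"
      using assms(5) unfolding local_fun_def by blast
    then obtain I where "\<forall>v. v < n \<longrightarrow> I v \<subseteq> ?U \<and> card (I v) \<le> d \<and>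
        (\<forall>x\<in>cube m. \<forall>y\<in>cube m. (\<forall>j\<in>I v. x ! j = y ! j) \<longrightarrow> f x ! v = f y ! v)"
      unfolding choice_iff by (rule exE)
    then show ?thesis using that[of I] by blast
  qed
  have local: "F v X = F v Y" if v: "v \<in> ?V" and eq: "X \<inter> I v = Y \<inter> I v" for v X Y
    unfolding F_def
  proof (rule dep[OF v])
    fix j assume j: "j \<in> I v"
    then have "j < m" "j \<in> X \<longleftrightarrow> j \<in> Y" using I(1)[OF v] eq by auto
    then show "bits m X ! j = bits m Y ! j" by (simp add: bits_def)
  qed (simp_all add: cube_def bits_def)
  have law: "push_unif f m (bits n Y) = law ?U F ?V Y" if Y: "Y \<in> Pow ?V" for Y
  proof -
    have "(f (bits m X) = bits n Y) = (out F ?V X = Y)" for X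
    proof -
      have "out F ?V X = support (f (bits m X))"
        using f[of X] by (auto simp: out_def support_def F_def cube_def)
      moreover have "f (bits m X) = bits n (support (f (bits m X)))"
        using f[of X] bits_support[of "f (bits m X)"] by (simp add: cube_def)
      ultimately show ?thesis using Y support_bits by (metis PowD)
    qed
    moreover have "real (card {x \<in> cube m. f x = bits n Y}) = (\<Sum>x\<in>cube m. of_bool (f x = bits n Y))"
      using finite_cube by (simp add: Int_def)
    ultimately show ?thesis unfolding push_unif_def law_def sum_cube by simp
  qed
  have D: "D_dist n q \<Lambda> (bits n Y) = of_bool (Y \<in> E) / card E" if "Y \<in> Pow ?V" for Y
  proof -
    have "bits n Y \<in> supp_D n q \<Lambda> \<longleftrightarrow> Y \<in> E"
      using that by (auto simp: supp_D_def E_def cube_def hweight_bits) (simp add: bits_def)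
    then show ?thesis by (simp add: D_dist_def card_supp_D E_def)
  qed
  obtain S M D where SM: "S \<subseteq> ?U" "M \<subseteq> ?V" "\<And>i. i \<in> M \<Longrightarrow> card (nbhd I ?V S i) \<le> D"
    "\<And>i. i \<in> M \<Longrightarrow> card (inputs I ?V S i) \<le> D" "disjoint_family_on (inputs I ?V S) M"
    and cS: "real (card S) * (32 * 4 ^ D) \<le> card M" and cV0: "real (card ?V) * (32 * 4 ^ D) \<le> real (card M) * real (tow2 (18 * d))"
    by (rule exists_nonconnected_neighbourhoods[OF finite_lessThan finite_lessThan assms(6) I]) (assumption | rule that)+
  have blocks: "nonconnected_blocks (?U - S) ?V (\<lambda>v. I v - S) (\<lambda>v X. F v (\<rho> \<union> (X - S))) M
    (nbhd I ?V S) (inputs I ?V S) D" for \<rho>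
    by (rule nonconnected_blocks_nbhd[where F = F, OF finite_lessThan finite_lessThan I(1) local SM(2-5)])
  have cV: "real n * (32 * 4 ^ D) \<le> real (card M) * T" using cV0 by (simp add: T_def)
  have T: "T > 0" using tow2_gt[of "18 * d"] by (simp add: T_def)
  have E: "card E > 0" "card E \<le> 2 ^ n"
  proof -
    show "card E > 0" using supp_D_nonempty[OF assms(2-4)] by (simp add: E_def card_gt_0_iff)
    have "card E \<le> card (Pow ?V)" by (intro card_mono) (auto simp: E_def)
    then show "card E \<le> 2 ^ n" by (simp add: card_Pow)
  qed
  have q2: "real q ^ 2 \<ge> 1" using assms(1) by (simp add: one_le_power)
  have A: "exp (- (card M / (8 * real q ^ 2 * 2 ^ D))) \<le> e"
  proof -
    have "(8 * 2 ^ D :: real) \<le> 32 * 4 ^ D" by (intro mult_mono power_mono) auto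
    then have "real n * (8 * 2 ^ D) \<le> real n * (32 * 4 ^ D)" by (rule mult_left_mono) simp
    then have "real n * (8 * 2 ^ D) \<le> real (card M) * T" using cV by simp
    then have "n / T \<le> card M / (8 * 2 ^ D)"
      using T by (simp add: pos_divide_le_eq pos_le_divide_eq)
    then have "n / T / real q ^ 2 \<le> card M / (8 * 2 ^ D) / real q ^ 2" by (rule divide_right_mono) simp
    then show ?thesis unfolding e_def by (simp add: mult_ac)
  qed
  \<comment> \<open>The bound on \<open>card S\<close> is half of the available exponent, so the
    union bound consumes one half and the other half still exceeds \<open>n / T\<close>.\<close>
  have B: "2 ^ card S * exp (- (card M / (16 * 4 ^ D))) \<le> e"
  proof -
    have "2 ^ card S * exp (- (card M / (16 * 4 ^ D))) \<le> exp (card S) * exp (- (card M / (16 * 4 ^ D)))"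
      by (intro mult_right_mono power_2_le_exp) simp
    also have "\<dots> = exp (card S - card M / (16 * 4 ^ D))" by (simp flip: exp_add)
    also have "\<dots> \<le> e"
    proof -
      have "card S \<le> card M / (32 * 4 ^ D)" using cS by (simp add: le_divide_eq)
      moreover have "card M / (16 * 4 ^ D) = 2 * (card M / (32 * 4 ^ D))" by simp
      moreover have "n / T \<le> card M / (32 * 4 ^ D)" using cV T by (simp add: pos_divide_le_eq pos_le_divide_eq)
      moreover have "n / (real q ^ 2 * T) \<le> n / T"
        using frac_le[of "n / T" "n / T" 1 "real q ^ 2"] q2 T by (simp add: mult.commute)
      ultimately show ?thesis unfolding e_def by simp
    qed
    finally show ?thesis .
  qed
  have r: "2 ^ n / real (card E) \<ge> 1"
  proof -
    have "real (card E) \<le> real (2 ^ n)" using E(2) by (simp only: of_nat_le_iff)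
    then show ?thesis using E(1) by simp
  qed
  have e0: "e \<ge> 0" by (simp add: e_def)
  have "(\<Sum>y\<in>cube n. min (push_unif f m y) (D_dist n q \<Lambda> y))
      = (\<Sum>Y\<in>Pow ?V. min (law ?U F ?V Y) (of_bool (Y \<in> E) / card E))"
    unfolding sum_cube using law D by (intro sum.cong refl) auto
  also have "\<dots> \<le> main_term q \<Lambda> + q * exp (- (card M / (8 * real q ^ 2 * 2 ^ D)))
       + 2 ^ card ?V / card E * (2 ^ card S * exp (- (card M / (16 * 4 ^ D))))"
    unfolding E_def
    by (rule overlap_bound[OF finite_lessThan finite_lessThan SM(1) blocks assms(1,3) supp_D_nonempty[OF assms(2-4)]])
  also have "\<dots> \<le> main_term q \<Lambda> + q * e + 2 ^ card ?V / card E * e"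
    by (intro add_mono mult_left_mono A B order_refl) auto
  also have "\<dots> \<le> main_term q \<Lambda> + 2 ^ n / card E * (6 * q) * e"
  proof -
    define x where "x = 2 ^ n / real (card E)"
    have x: "x \<ge> 1" using r by (simp add: x_def)
    \<comment> \<open>Both error terms are brought under the factor \<open>x\<close>, the inverse
      density of the support; even \<open>2 * real q\<close> would suffice in place of
      \<open>6 * real q\<close>.\<close>
    have "real q * e \<le> x * (real q * e)" using mult_right_mono[OF x, of "real q * e"] e0 by simp
    moreover have "x * (1 * e) \<le> x * (real q * e)"
      using assms(1) e0 x by (intro mult_left_mono mult_right_mono) auto
    moreover have "0 \<le> x * (real q * e)" using e0 x by simp
    moreover have "x * (6 * real q) * e = 6 * (x * (real q * e))" by simp
    ultimately have "real q * e + x * e \<le> x * (6 * real q) * e" by simp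
    then show ?thesis by (simp add: x_def)
  qed
  also have "2 ^ n / card E * (6 * q) = 6 * real q / (real (card (supp_D n q \<Lambda>)) / 2 ^ n)"
    by (simp add: card_supp_D E_def)
  finally show ?thesis unfolding e_def T_def .
qed

theorem mainTheorem11:
  fixes n q m d :: nat and \<Lambda> :: "nat set" and f :: "bool list \<Rightarrow> bool list"
  assumes "n \<ge> 1" and "3 \<le> q" and "q \<le> n"
    and "\<Lambda> \<subseteq> {..<q}" and "\<Lambda> \<noteq> {}"
    and "local_fun m n d f"
  shows "tv_dist n (push_unif f m) (D_dist n q \<Lambda>) \<ge>
     1 - (6 * real q / (real (card (supp_D n q \<Lambda>)) / 2 ^ n))
           * exp (- (real n / (real q ^ 2 * real (tow2 (18 * d)))))
       - (if odd q then real (card \<Lambda>) / real q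
          else 2 * real (max (card {l\<in>\<Lambda>. even l}) (card {l\<in>\<Lambda>. odd l})) / real q)"
proof -
  have f: "f x \<in> cube n" if "x \<in> cube m" for x using assms(6) that by (simp add: local_fun_def)
  have ne: "supp_D n q \<Lambda> \<noteq> {}" using supp_D_nonempty[OF assms(3-5)] by (simp add: supp_D_eq)
  have "(\<Sum>y\<in>cube n. min (push_unif f m y) (D_dist n q \<Lambda> y))
    \<le> main_term q \<Lambda> + (6 * real q / (real (card (supp_D n q \<Lambda>)) / 2 ^ n))
           * exp (- (real n / (real q ^ 2 * real (tow2 (18 * d)))))"
  proof (cases "d \<ge> 1")
    case True
    then show ?thesis using local_overlap assms by blast
  next
    case False
    \<comment> \<open>For \<open>d = 0\<close> the sets of relevant inputs are empty, so
      \<open>f\<close> is constant. The case is separate because the tower estimate requires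
      \<open>1 \<le> d\<close>.\<close>
    have "f x = f (bits m {})" if x: "x \<in> cube m" for x
    proof (rule nth_equalityI)
      have b: "bits m {} \<in> cube m" by (simp add: bits_def cube_def)
      then show "length (f x) = length (f (bits m {}))" using f[OF x] f[OF b] by (simp add: cube_def)
      fix i assume "i < length (f x)"
      then have "i < n" using f[OF x] by (simp add: cube_def)
      moreover have "d = 0" using False by simp
      ultimately obtain S where sub: "S \<subseteq> {..<m}" and card: "card S \<le> 0"
        and S: "\<forall>x\<in>cube m. \<forall>y\<in>cube m. (\<forall>j\<in>S. x ! j = y ! j) \<longrightarrow> f x ! i = f y ! i"
        using assms(6) unfolding local_fun_def by blast
      have "finite S" using sub by (rule finite_subset) simp
      then have "S = {}" using card by simp
      then show "f x ! i = f (bits m {}) ! i" using S x b by blast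
    qed
    then have "(\<Sum>y\<in>cube n. min (push_unif f m y) (D_dist n q \<Lambda> y)) \<le> 1 / real (card (supp_D n q \<Lambda>))"
      by (rule constant_overlap)
    also have "\<dots> \<le> 2 ^ n / real (card (supp_D n q \<Lambda>)) * (6 * real q * exp (- (real n / (real q ^ 2 * real (tow2 (18 * d))))))"
    proof -
      \<comment> \<open>Here the tower equals 1 and \<open>q \<ge> 3\<close>, so the exponential is
        at least \<open>exp (- (n / 2))\<close>, and \<open>exp (n / 2) \<le> 2 ^ n\<close> makes
        the claimed error exceed one atom of the target law.\<close>
      have q2: "3 ^ 2 \<le> real q ^ 2" using assms(2) by (intro power_mono) auto
      have "tow2 (18 * d) = 1" using False by (cases d) auto
      moreover have "real n / real q ^ 2 \<le> real n / 3 ^ 2" using q2 assms(2) by (intro divide_left_mono) auto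
      ultimately have le: "real n / (real q ^ 2 * real (tow2 (18 * d))) \<le> real n / 2" by simp
      have "1 \<le> exp (real n / 2) * exp (- (real n / (real q ^ 2 * real (tow2 (18 * d)))))"
        using le by (simp flip: exp_add)
      also have "\<dots> \<le> 2 ^ n * exp (- (real n / (real q ^ 2 * real (tow2 (18 * d)))))"
      proof (rule mult_right_mono)
        have "exp (1 / 2 :: real) \<le> 2"
        proof -
          have "exp (1 / 2 :: real) ^ 2 = exp 1" by (simp flip: exp_of_nat_mult)
          also have "\<dots> \<le> 2 ^ 2" using exp_le by simp
          finally show ?thesis by (rule power2_le_imp_le) simp
        qed
        then have "exp (1 / 2 :: real) ^ n \<le> 2 ^ n" by (intro power_mono) auto
        then show "exp (real n / 2) \<le> 2 ^ n" by (simp flip: exp_of_nat_mult)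
      qed simp
      also have "\<dots> \<le> (6 * real q) * (2 ^ n * exp (- (real n / (real q ^ 2 * real (tow2 (18 * d))))))"
        using mult_right_mono[of 1 "6 * real q" "2 ^ n * exp (- (real n / (real q ^ 2 * real (tow2 (18 * d)))))"] assms(2) by simp
      finally have "1 / real (card (supp_D n q \<Lambda>)) \<le>
        (6 * real q) * (2 ^ n * exp (- (real n / (real q ^ 2 * real (tow2 (18 * d)))))) / real (card (supp_D n q \<Lambda>))"
        by (rule divide_right_mono) simp
      then show ?thesis by (simp add: mult_ac)
    qed
    also have "\<dots> = (6 * real q / (real (card (supp_D n q \<Lambda>)) / 2 ^ n)) * exp (- (real n / (real q ^ 2 * real (tow2 (18 * d)))))"
      by simp
    finally show ?thesis using main_term_nonneg[of q \<Lambda>] by linarith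
  qed
  moreover have "tv_dist n (push_unif f m) (D_dist n q \<Lambda>) = 1 - (\<Sum>y\<in>cube n. min (push_unif f m y) (D_dist n q \<Lambda> y))"
    by (rule tv_dist_eq[OF sum_push_unif[OF f] sum_D_dist[OF ne]])
  ultimately show ?thesis unfolding main_term_def by linarith
qed

end
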